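(* Let $\mathcal{F}\colon\mathcal{M}\to\mathbb{R}$ be a functional. The Hamilton-Jacobi equation in positive density space associated with the Lagrangian $\frac12 g(u)(\sigma,\sigma)-\mathcal{F}(u)$, for a value functional $\mathcal{U}(t,u)$, $t\in[0,1]$, is $$\partial_t\mathcal{U}(t,u)+\frac12\int_\Omega\Big\|\nabla\frac{\delta}{\delta u(x)}\mathcal{U}(t,u)\Big\|^2V_1(u)\,dx+\frac12\int_\Omega\Big|\frac{\delta}{\delta u(x)}\mathcal{U}(t,u)\Big|^2V_2(u)\,dx+\mathcal{F}(u)=0 .$$
   Context: $\Omega\subset\mathbb{R}^d$ is a compact convex spatial domain with periodic boundary conditions (a box with opposite faces identified), so integration by parts produces no boundary terms. $\mathcal{M}=\{u\in C^\infty(\Omega):u>0\}$, with tangent space $T_u\mathcal{M}=C^\infty(\Omega)$. $F,G,R$ are smooth real functions on $(0,\infty)$ with $F'(u)>0$, $G''(u)>0$ for $u>0$; $V_1(u)=\frac{F'(u)}{G''(u)}$ and $V_2(u)=-\frac{R(u)}{G'(u)}$, where $V_2$ is understood as a smooth positive function on $(0,\infty)$ with $V_2G'=-R$. The mean-field information metric is $g(u)(\sigma_1,\sigma_2)=\int_\Omega\sigma_1\big(-\nabla\cdot(V_1(u)\nabla)+V_2(u)\big)^{-1}\sigma_2\,dx$ for $\sigma_1,\sigma_2\in T_u\mathcal{M}$. Given a Lagrangian $\mathcal{L}(u,\sigma)$ on $T\mathcal{M}$, its Hamiltonian is the convex conjugate $\mathcal{H}(u,\Phi)=\sup_{\sigma\in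 C^\infty(\Omega)}\big\{\int_\Omega\Phi\,\sigma\,dx-\mathcal{L}(u,\sigma)\big\}$ for $\Phi\in C^\infty(\Omega)$. The associated Hamilton-Jacobi equation for a functional $\mathcal{U}(t,u)$, differentiable in $t$ and with $L^2$ first variation $\frac{\delta}{\delta u(x)}\mathcal{U}(t,u)$ smooth in $x$, is $\partial_t\mathcal{U}(t,u)+\mathcal{H}\big(u,\frac{\delta}{\delta u}\mathcal{U}(t,u)\big)=0$. The $L^2$ first variation is defined by $\frac{d}{d\epsilon}|_{\epsilon=0}\mathcal{U}(t,u+\epsilon\eta)=\int_\Omega\frac{\delta}{\delta u(x)}\mathcal{U}(t,u)\,\eta(x)\,dx$ for all $\eta\in C^\infty(\Omega)$. *)

theory Defs
  imports "HOL-Analysis.Analysis"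
begin

definition partial_deriv :: "'n::finite \<Rightarrow> (real ^ 'n \<Rightarrow> real) \<Rightarrow> real ^ 'n \<Rightarrow> real" where
  "partial_deriv i f x = frechet_derivative f (at x) (axis i 1)"

definition gradient :: "(real ^ 'n \<Rightarrow> real) \<Rightarrow> real ^ 'n \<Rightarrow> real ^ 'n" where
  "gradient f x = (\<chi> i. partial_deriv i f x)"

definition divergence :: "(real ^ 'n \<Rightarrow> real ^ 'n) \<Rightarrow> real ^ 'n \<Rightarrow> real" where
  "divergence v x = (\<Sum>i\<in>UNIV. partial_deriv i (\<lambda>y. v y $ i) x)"

primrec Ck :: "nat \<Rightarrow> (real ^ 'n \<Rightarrow> real) \<Rightarrow> bool" where
  "Ck 0 f \<longleftrightarrow> continuous_on UNIV f"
| "Ck (Suc k) f \<longleftrightarrow> (\<forall>x. f differentiable (at x)) \<and> (\<forall>i. Ck k (partial_deriv i f))"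

definition smooth :: "(real ^ 'n \<Rightarrow> real) \<Rightarrow> bool" where
  "smooth f \<longleftrightarrow> (\<forall>k. Ck k f)"

definition smooth_on_pos :: "(real \<Rightarrow> real) \<Rightarrow> bool" where
  "smooth_on_pos f \<longleftrightarrow> (\<forall>k. \<forall>r>0. (deriv ^^ k) f differentiable (at r))"

(* The spatial domain is the box cbox a b with opposite faces identified.  A function on it
   is represented by its periodic extension to the whole space, so smoothness includes
   matching of all derivatives across the identified faces. *)

definition box_periodic :: "real ^ 'n \<Rightarrow> real ^ 'n \<Rightarrow> (real ^ 'n \<Rightarrow> real) \<Rightarrow> bool" where
  "box_periodic a b f \<longleftrightarrow> (\<forall>i x. f (x + axis i (b $ i - a $ i)) = f x)"

definition Cinf :: "real ^ 'n \<Rightarrow> real ^ 'n \<Rightarrow> (real ^ 'n \<Rightarrow> real) set" where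
  "Cinf a b = {f. smooth f \<and> box_periodic a b f}"

definition pos_densities :: "real ^ 'n \<Rightarrow> real ^ 'n \<Rightarrow> (real ^ 'n \<Rightarrow> real) set" where
  "pos_densities a b = {u \<in> Cinf a b. \<forall>x. u x > 0}"

definition elliptic_op ::
    "(real \<Rightarrow> real) \<Rightarrow> (real \<Rightarrow> real) \<Rightarrow> (real ^ 'n \<Rightarrow> real) \<Rightarrow> (real ^ 'n \<Rightarrow> real) \<Rightarrow> real ^ 'n \<Rightarrow> real" where
  "elliptic_op V1 V2 u \<phi> x =
     - divergence (\<lambda>y. V1 (u y) *\<^sub>R gradient \<phi> y) x + V2 (u x) * \<phi> x"

(* For positive smooth coefficients the elliptic operator is a bijection of Cinf a b, so
   inv_into is its genuine inverse there. *)
definition mf_metric ::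
    "real ^ 'n \<Rightarrow> real ^ 'n \<Rightarrow> (real \<Rightarrow> real) \<Rightarrow> (real \<Rightarrow> real) \<Rightarrow>
     (real ^ 'n \<Rightarrow> real) \<Rightarrow> (real ^ 'n \<Rightarrow> real) \<Rightarrow> (real ^ 'n \<Rightarrow> real) \<Rightarrow> real" where
  "mf_metric a b V1 V2 u \<sigma>1 \<sigma>2 =
     integral (cbox a b) (\<lambda>x. \<sigma>1 x * inv_into (Cinf a b) (elliptic_op V1 V2 u) \<sigma>2 x)"

definition hamiltonian ::
    "real ^ 'n \<Rightarrow> real ^ 'n \<Rightarrow> ((real ^ 'n \<Rightarrow> real) \<Rightarrow> (real ^ 'n \<Rightarrow> real) \<Rightarrow> real) \<Rightarrow>
     (real ^ 'n \<Rightarrow> real) \<Rightarrow> (real ^ 'n \<Rightarrow> real) \<Rightarrow> ereal" where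
  "hamiltonian a b L u \<Phi> =
     (SUP \<sigma>\<in>Cinf a b. ereal (integral (cbox a b) (\<lambda>x. \<Phi> x * \<sigma> x) - L u \<sigma>))"

(* The perturbation u + eps * eta of a positive density leaves the positive densities for
   large eps; only its values for small eps, where it stays inside, matter here. *)
definition is_first_variation ::
    "real ^ 'n \<Rightarrow> real ^ 'n \<Rightarrow> ((real ^ 'n \<Rightarrow> real) \<Rightarrow> real) \<Rightarrow>
     (real ^ 'n \<Rightarrow> real) \<Rightarrow> (real ^ 'n \<Rightarrow> real) \<Rightarrow> bool" where
  "is_first_variation a b W u \<Phi> \<longleftrightarrow> \<Phi> \<in> Cinf a b \<and>
     (\<forall>\<eta>\<in>Cinf a b. ((\<lambda>\<epsilon>. W (\<lambda>x. u x + \<epsilon> * \<eta> x))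
        has_real_derivative integral (cbox a b) (\<lambda>x. \<Phi> x * \<eta> x)) (at 0))"

definition first_variation ::
    "real ^ 'n \<Rightarrow> real ^ 'n \<Rightarrow> ((real ^ 'n \<Rightarrow> real) \<Rightarrow> real) \<Rightarrow>
     (real ^ 'n \<Rightarrow> real) \<Rightarrow> real ^ 'n \<Rightarrow> real" where
  "first_variation a b W u = (THE \<Phi>. is_first_variation a b W u \<Phi>)"

(* One-sided derivative at the end points of the time interval. *)
definition time_deriv ::
    "(real \<Rightarrow> (real ^ 'n \<Rightarrow> real) \<Rightarrow> real) \<Rightarrow> real \<Rightarrow> (real ^ 'n \<Rightarrow> real) \<Rightarrow> real" where
  "time_deriv U t u = vector_derivative (\<lambda>s. U s u) (at t within {0..1})"

definition value_functional ::
    "real ^ 'n \<Rightarrow> real ^ 'n \<Rightarrow> (real \<Rightarrow> (real ^ 'n \<Rightarrow> real) \<Rightarrow> real) \<Rightarrow> bool" where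
  "value_functional a b U \<longleftrightarrow> (\<forall>t\<in>{0..1}. \<forall>u\<in>pos_densities a b.
     (\<lambda>s. U s u) differentiable (at t within {0..1}) \<and>
     (\<exists>\<Phi>. is_first_variation a b (U t) u \<Phi>))"

definition hamilton_jacobi ::
    "real ^ 'n \<Rightarrow> real ^ 'n \<Rightarrow> ((real ^ 'n \<Rightarrow> real) \<Rightarrow> (real ^ 'n \<Rightarrow> real) \<Rightarrow> real) \<Rightarrow>
     (real \<Rightarrow> (real ^ 'n \<Rightarrow> real) \<Rightarrow> real) \<Rightarrow> real \<Rightarrow> (real ^ 'n \<Rightarrow> real) \<Rightarrow> bool" where
  "hamilton_jacobi a b L U t u \<longleftrightarrow>
     ereal (time_deriv U t u) + hamiltonian a b L u (first_variation a b (U t) u) = 0"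

end

theory Submission
  imports Defs
begin

text \<open>
  Write \<open>A\<close> for the elliptic operator. If \<open>\<sigma> = A \<phi>\<close>, then by Green's formula the expression under the
  supremum is \<open>E(\<phi>,\<Phi>) - E(\<phi>,\<phi>)/2 + \<F>(u)\<close>, where \<open>E\<close> is the positive semidefinite Dirichlet form
  of \<open>A\<close>; it is at most \<open>E(\<Phi>,\<Phi>)/2 + \<F>(u)\<close>, with equality for \<open>\<sigma> = A \<Phi>\<close>. This settles the
  supremum only if every smooth periodic \<open>\<sigma>\<close> is of the form \<open>A \<phi>\<close>.

  To solve \<open>A \<phi> = f\<close>, divide by \<open>V1(u)\<close>, which leaves an equation with leading part the Laplacian, and replace
  derivatives (but not the variable \<open>x\<close>) by centred differences of step \<open>h\<close>. The resulting equation is a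
  sup-norm contraction on smooth periodic functions, because for small \<open>h\<close> it expresses \<open>\<phi>(x)\<close> by a subconvex
  combination of the \<open>\<phi>(x \<plusminus> h e\<^sub>i)\<close>. The discrete maximum principle and Bernstein's method bound every iterated
  partial derivative of its solution uniformly in \<open>h\<close>. By the maximum principle and consistency the solutions are
  uniformly Cauchy as \<open>h\<close> tends to 0, by interpolation so are all their derivatives, and the limit solves the equation.
\<close>

subsection \<open>Partial derivatives\<close>

text \<open>The obstacle is surjectivity of \<open>A\<close> inside the smooth functions, reached
  here by sup-norm estimates alone. With \<open>x\<close> kept continuous, every difference operator
  is a combination of translations: it preserves smooth periodic functions, is compatible with the
  periods for any step, and commutes with partial derivatives. Dividing by \<open>V1(u)\<close>
  gives the second differences constant coefficients, so differentiating the discrete equation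
  leaves only first differences of lower derivatives. At order \<open>s\<close> these include first
  differences of derivatives of order \<open>s - 1\<close>, which are as strong as the unknown; the
  squares of the lower derivatives, added with a large weight, supply the squares of these
  differences with a favourable sign. The zero-order coefficient has a positive lower bound on the
  torus: it is the source of the strict contraction, of the maximum principle bound and of the
  damping in the derivative estimates. The consistency error involves third derivatives, which is
  why bounds uniform in \<open>h\<close> precede the limit.\<close>

lemma partial_deriv_eq:
  assumes "(f has_derivative f') (at x)"
  shows "partial_deriv i f x = f' (axis i 1)"
  using frechet_derivative_at[OF assms] by (simp add: partial_deriv_def)

text \<open>Puts the total derivative into coordinates, the form in which the theorem on limits of
  derivatives is applied to sequences.\<close>

lemma has_derivative_gradient:
  fixes f :: "real ^ 'n \<Rightarrow> real"
  assumes "f differentiable (at x)"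
  shows "(f has_derivative (\<lambda>h. \<Sum>i\<in>UNIV. partial_deriv i f x * h $ i)) (at x)"
proof -
  let ?D = "frechet_derivative f (at x)"
  have D: "(f has_derivative ?D) (at x)"
    using assms frechet_derivative_works by blast
  have lin: "linear ?D" using D has_derivative_linear by blast
  have "?D h = (\<Sum>i\<in>UNIV. partial_deriv i f x * h $ i)" for h
  proof -
    have "?D h = ?D (\<Sum>i\<in>UNIV. h $ i *s axis i 1)" by (simp add: basis_expansion)
    also have "\<dots> = (\<Sum>i\<in>UNIV. h $ i * ?D (axis i 1))"
      using lin by (simp add: linear_sum linear_cmul scalar_mult_eq_scaleR)
    finally show ?thesis by (simp add: partial_deriv_def mult.commute)
  qed
  then have "?D = (\<lambda>h. \<Sum>i\<in>UNIV. partial_deriv i f x * h $ i)" by blast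
  then show ?thesis using D by metis
qed

text \<open>Restriction to a coordinate line makes the mean value theorem of one variable
  available.\<close>

lemma partial_deriv_line:
  fixes f :: "real ^ 'n \<Rightarrow> real"
  assumes "f differentiable (at (x + s *\<^sub>R axis i 1))"
  shows "((\<lambda>s. f (x + s *\<^sub>R axis i 1)) has_real_derivative
           partial_deriv i f (x + s *\<^sub>R axis i 1)) (at s)"
proof -
  let ?y = "x + s *\<^sub>R axis i 1" and ?\<gamma> = "\<lambda>s. x + s *\<^sub>R axis i (1::real)"
  have "(f has_derivative frechet_derivative f (at ?y)) (at (?\<gamma> s))"
    using assms frechet_derivative_works by blast
  moreover have "(?\<gamma> has_derivative (\<lambda>r. r *\<^sub>R axis i 1)) (at s)"
    by (auto intro!: derivative_eq_intros)
  ultimately have "((\<lambda>s. f (?\<gamma> s)) has_derivative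
      (\<lambda>r. frechet_derivative f (at ?y) (r *\<^sub>R axis i 1))) (at s)"
    using has_derivative_compose by blast
  moreover have "frechet_derivative f (at ?y) (r *\<^sub>R axis i 1) = partial_deriv i f ?y * r" for r
    using linear_frechet_derivative[OF assms] by (simp add: linear_cmul partial_deriv_def)
  ultimately show ?thesis by (simp add: has_field_derivative_def)
qed

lemma partial_deriv_const [simp]: "partial_deriv i (\<lambda>x. c) = (\<lambda>x. 0)"
  by (rule ext) (simp add: partial_deriv_eq[OF has_derivative_const])

lemma partial_deriv_add:
  assumes "f differentiable (at x)" "g differentiable (at x)"
  shows "partial_deriv i (\<lambda>x. f x + g x) x = partial_deriv i f x + partial_deriv i g x"
  using partial_deriv_eq[OF has_derivative_add[OF assms[unfolded frechet_derivative_works]]]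
  by (simp add: partial_deriv_def)

lemma partial_deriv_mult:
  assumes "f differentiable (at x)" "g differentiable (at x)"
  shows "partial_deriv i (\<lambda>x. f x * g x) x = partial_deriv i f x * g x + f x * partial_deriv i g x"
  using partial_deriv_eq[OF has_derivative_mult[OF assms[unfolded frechet_derivative_works]]]
  by (simp add: partial_deriv_def)

lemma partial_deriv_chain:
  assumes "f differentiable (at x)" "(\<phi> has_real_derivative d) (at (f x))"
  shows "(\<lambda>x. \<phi> (f x)) differentiable (at x)"
    and "partial_deriv i (\<lambda>x. \<phi> (f x)) x = d * partial_deriv i f x"
proof -
  have *: "((\<lambda>x. \<phi> (f x)) has_derivative (\<lambda>h. d * frechet_derivative f (at x) h)) (at x)"
    using has_derivative_compose[OF assms(1)[unfolded frechet_derivative_works]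
        assms(2)[unfolded has_field_derivative_def]] .
  then show "(\<lambda>x. \<phi> (f x)) differentiable (at x)" using differentiable_def by blast
  show "partial_deriv i (\<lambda>x. \<phi> (f x)) x = d * partial_deriv i f x"
    using partial_deriv_eq[OF *] by (simp add: partial_deriv_def)
qed

lemma shift_has_derivative:
  fixes f :: "real ^ 'n \<Rightarrow> real"
  assumes "f differentiable (at (x + v))"
  shows "((\<lambda>x. f (x + v)) has_derivative frechet_derivative f (at (x + v))) (at x)"
proof -
  have "((\<lambda>x. x + v) has_derivative (\<lambda>h. h)) (at x)" by (auto intro!: derivative_eq_intros)
  from has_derivative_compose[OF this, of f "frechet_derivative f (at (x + v))"]
  show ?thesis using assms frechet_derivative_works by blast
qed

lemma partial_deriv_shift:
  fixes f :: "real ^ 'n \<Rightarrow> real"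
  assumes "f differentiable (at (x + v))"
  shows "partial_deriv i (\<lambda>x. f (x + v)) x = partial_deriv i f (x + v)"
  using partial_deriv_eq[OF shift_has_derivative[OF assms]] by (simp add: partial_deriv_def)

lemma Ck_differentiable: "Ck (Suc k) f \<Longrightarrow> f differentiable (at x)" by simp

lemma Ck_Suc: "Ck (Suc k) f \<Longrightarrow> Ck k f"
proof (induction k arbitrary: f)
  case 0
  then show ?case
    by (auto intro!: continuous_at_imp_continuous_on differentiable_imp_continuous_within)
next
  case (Suc k)
  then show ?case by (metis Ck.simps(2))
qed

lemma Ck_const: "Ck k (\<lambda>x. c)"
  by (induction k arbitrary: c) simp_all

lemma Ck_add: "Ck k f \<Longrightarrow> Ck k g \<Longrightarrow> Ck k (\<lambda>x. f x + g x)"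
proof (induction k arbitrary: f g)
  case 0
  then show ?case by (simp add: continuous_on_add)
next
  case (Suc k)
  have "partial_deriv i (\<lambda>x. f x + g x) = (\<lambda>x. partial_deriv i f x + partial_deriv i g x)" for i
    using Suc.prems by (intro ext partial_deriv_add) auto
  then show ?case using Suc by auto
qed

lemma Ck_mult: "Ck k f \<Longrightarrow> Ck k g \<Longrightarrow> Ck k (\<lambda>x. f x * g x)"
proof (induction k arbitrary: f g)
  case 0
  then show ?case by (simp add: continuous_on_mult)
next
  case (Suc k)
  have "partial_deriv i (\<lambda>x. f x * g x)
      = (\<lambda>x. partial_deriv i f x * g x + f x * partial_deriv i g x)" for i
    using Suc.prems by (intro ext partial_deriv_mult) auto
  moreover have "Ck k f" "Ck k g" using Suc.prems Ck_Suc by blast+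
  ultimately show ?case using Suc by (auto intro!: Ck_add)
qed

lemma Ck_shift: "Ck k f \<Longrightarrow> Ck k (\<lambda>x. f (x + v))"
proof (induction k arbitrary: f)
  case 0
  then have "continuous_on UNIV f" by simp
  then have "continuous_on UNIV (\<lambda>x. f (x + v))"
    by (rule continuous_on_compose2) (auto intro!: continuous_intros)
  then show ?case by simp
next
  case (Suc k)
  have "partial_deriv i (\<lambda>x. f (x + v)) = (\<lambda>x. partial_deriv i f (x + v))" for i
    using Suc.prems by (intro ext partial_deriv_shift) auto
  moreover have "(\<lambda>x. f (x + v)) differentiable (at x)" for x
    using Suc.prems shift_has_derivative[of f x v] differentiable_def by (metis Ck_differentiable)
  ultimately show ?case using Suc by auto
qed

lemma smooth_on_pos_deriv: "smooth_on_pos \<phi> \<Longrightarrow> smooth_on_pos (deriv \<phi>)"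
  unfolding smooth_on_pos_def by (metis funpow_Suc_right o_apply)

lemma smooth_on_pos_DERIV:
  assumes "smooth_on_pos \<phi>" "r > 0"
  shows "(\<phi> has_real_derivative deriv \<phi> r) (at r)"
  using assms DERIV_deriv_iff_real_differentiable unfolding smooth_on_pos_def
  by (metis funpow_0)

text \<open>The induction runs over all \<open>\<phi>\<close> at once: the chain rule replaces
  \<open>\<phi>\<close> by its derivative, which is again smooth on the half line where
  \<open>u\<close> takes its values.\<close>

lemma Ck_compose:
  assumes "smooth_on_pos \<phi>" "\<And>k. Ck k u" "\<And>x. u x > 0"
  shows "Ck k (\<lambda>x. \<phi> (u x))"
  using assms(1)
proof (induction k arbitrary: \<phi>)
  case 0
  have "(\<lambda>x. \<phi> (u x)) differentiable (at x)" for x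
    using partial_deriv_chain(1) smooth_on_pos_DERIV[OF 0 assms(3)] assms(2) Ck_differentiable by blast
  then show ?case
    by (auto intro!: continuous_at_imp_continuous_on differentiable_imp_continuous_within)
next
  case (Suc k)
  have "(\<lambda>x. \<phi> (u x)) differentiable (at x)" for x
    using partial_deriv_chain(1) smooth_on_pos_DERIV[OF Suc.prems assms(3)] assms(2) Ck_differentiable by blast
  moreover have "partial_deriv i (\<lambda>x. \<phi> (u x)) = (\<lambda>x. deriv \<phi> (u x) * partial_deriv i u x)" for i
    using partial_deriv_chain(2) smooth_on_pos_DERIV[OF Suc.prems assms(3)] assms(2) Ck_differentiable
    by blast
  moreover have "Ck k (\<lambda>x. deriv \<phi> (u x) * partial_deriv i u x)" for i
    using Suc.IH[OF smooth_on_pos_deriv[OF Suc.prems]] assms(2)[of "Suc k"] by (auto intro: Ck_mult)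
  ultimately show ?case by simp
qed

text \<open>The derivative of \<open>1/u\<close> is \<open>- (1/u)\<^sup>2\<close> times a
  derivative of \<open>u\<close>, so the reciprocal reproduces itself and the induction on the order
  closes with \<open>Ck_mult\<close>.\<close>

lemma Ck_inverse:
  assumes "\<And>k. Ck k u" "\<And>x. u x > (0::real)"
  shows "Ck k (\<lambda>x. inverse (u x))"
proof -
  have D: "(inverse has_real_derivative - (inverse (u x) * inverse (u x))) (at (u x))" for x
    using assms(2)[of x] by (auto intro!: derivative_eq_intros)
  have diff: "(\<lambda>x. inverse (u x)) differentiable (at x)" for x
    by (rule partial_deriv_chain(1)[OF Ck_differentiable[OF assms(1)] D])
  have pd: "partial_deriv i (\<lambda>x. inverse (u x))
      = (\<lambda>x. - 1 * ((inverse (u x) * inverse (u x)) * partial_deriv i u x))" for i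
    by (rule ext) (simp add: partial_deriv_chain(2)[OF Ck_differentiable[OF assms(1)] D])
  show ?thesis
  proof (induction k)
    case 0
    then show ?case
      using diff by (auto intro!: continuous_at_imp_continuous_on differentiable_imp_continuous_within)
  next
    case (Suc k)
    then show ?case
      unfolding Ck.simps pd using diff assms(1)[of "Suc k"]
      by (intro conjI allI Ck_mult[OF Ck_const] Ck_mult) auto
  qed
qed

subsection \<open>Smooth periodic functions\<close>

lemma smooth_differentiable: "smooth f \<Longrightarrow> f differentiable (at x)"
  unfolding smooth_def using Ck_differentiable by blast

lemma smooth_continuous: "smooth f \<Longrightarrow> continuous_on S f"
  unfolding smooth_def using continuous_on_subset by (metis Ck.simps(1) subset_UNIV)

lemma smooth_partial_deriv: "smooth f \<Longrightarrow> smooth (partial_deriv i f)"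
  unfolding smooth_def using Ck.simps(2) by blast

lemma Cinf_smooth: "f \<in> Cinf a b \<Longrightarrow> smooth f" by (simp add: Cinf_def)

lemma Cinf_const: "(\<lambda>x. c) \<in> Cinf a b"
  by (simp add: Cinf_def smooth_def box_periodic_def Ck_const)

lemma Cinf_add: "f \<in> Cinf a b \<Longrightarrow> g \<in> Cinf a b \<Longrightarrow> (\<lambda>x. f x + g x) \<in> Cinf a b"
  by (simp add: Cinf_def smooth_def box_periodic_def Ck_add)

lemma Cinf_mult: "f \<in> Cinf a b \<Longrightarrow> g \<in> Cinf a b \<Longrightarrow> (\<lambda>x. f x * g x) \<in> Cinf a b"
  by (simp add: Cinf_def smooth_def box_periodic_def Ck_mult)

lemma Cinf_minus: "f \<in> Cinf a b \<Longrightarrow> (\<lambda>x. - f x) \<in> Cinf a b"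
  using Cinf_mult[OF Cinf_const[of "-1"]] by simp

lemma Cinf_diff: "f \<in> Cinf a b \<Longrightarrow> g \<in> Cinf a b \<Longrightarrow> (\<lambda>x. f x - g x) \<in> Cinf a b"
  using Cinf_add[OF _ Cinf_minus] by simp

lemma Cinf_sum: "(\<And>j. j \<in> J \<Longrightarrow> f j \<in> Cinf a b) \<Longrightarrow> (\<lambda>x. \<Sum>j\<in>J. f j x) \<in> Cinf a b"
  by (induction J rule: infinite_finite_induct) (auto intro: Cinf_const Cinf_add)

lemma Cinf_divide_const: "f \<in> Cinf a b \<Longrightarrow> (\<lambda>x. f x / c) \<in> Cinf a b"
  using Cinf_mult[OF _ Cinf_const[of "inverse c"]] by (simp add: divide_inverse)

lemma Cinf_power2: "f \<in> Cinf a b \<Longrightarrow> (\<lambda>x. (f x)\<^sup>2) \<in> Cinf a b"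
  using Cinf_mult[of f a b f] by (simp add: power2_eq_square)

lemma Cinf_shift: "f \<in> Cinf a b \<Longrightarrow> (\<lambda>x. f (x + v)) \<in> Cinf a b"
  unfolding Cinf_def smooth_def box_periodic_def
  by (auto intro: Ck_shift simp: add.commute add.left_commute)
     (metis add.assoc add.commute)

lemma Cinf_shift': "f \<in> Cinf a b \<Longrightarrow> (\<lambda>x. f (x - v)) \<in> Cinf a b"
  using Cinf_shift[of f a b "- v"] by simp

lemma Cinf_partial_deriv:
  assumes "f \<in> Cinf a b"
  shows "partial_deriv i f \<in> Cinf a b"
proof -
  have sm: "smooth f" using assms Cinf_smooth by blast
  have "partial_deriv i f (x + axis j (b $ j - a $ j)) = partial_deriv i f x" for j x
  proof -
    have "(\<lambda>x. f (x + axis j (b $ j - a $ j))) = f"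
      using assms by (auto simp: Cinf_def box_periodic_def)
    then show ?thesis using partial_deriv_shift[OF smooth_differentiable[OF sm]] by metis
  qed
  then show ?thesis using smooth_partial_deriv[OF sm] by (simp add: Cinf_def box_periodic_def)
qed

lemma Cinf_compose:
  assumes "smooth_on_pos \<phi>" "u \<in> pos_densities a b"
  shows "(\<lambda>x. \<phi> (u x)) \<in> Cinf a b"
  using assms Ck_compose[OF assms(1), of u]
  by (auto simp: Cinf_def pos_densities_def smooth_def box_periodic_def)

lemma Cinf_inverse:
  assumes "f \<in> Cinf a b" "\<And>x. f x > 0"
  shows "(\<lambda>x. inverse (f x)) \<in> Cinf a b"
  using assms Ck_inverse[of f] by (auto simp: Cinf_def smooth_def box_periodic_def)

section \<open>Reduction to the period box and compactness\<close>

lemma box_periodic_of_int: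
  assumes "box_periodic a b f"
  shows "f (x + of_int k *\<^sub>R axis i (b $ i - a $ i)) = f x"
proof -
  have pos: "f (x + of_nat m *\<^sub>R axis i (b $ i - a $ i)) = f x" for x m
  proof (induction m)
    case (Suc m)
    have "x + of_nat (Suc m) *\<^sub>R axis i (b $ i - a $ i)
        = (x + of_nat m *\<^sub>R axis i (b $ i - a $ i)) + axis i (b $ i - a $ i)"
      by (simp add: algebra_simps)
    then show ?case using Suc assms unfolding box_periodic_def by metis
  qed simp
  show ?thesis
  proof (cases "k \<ge> 0")
    case True
    then show ?thesis using pos[of x "nat k"] by simp
  next
    case False
    then show ?thesis
      using pos[of "x + of_int k *\<^sub>R axis i (b $ i - a $ i)" "nat (- k)"] by simp
  qed
qed

text \<open>The representative \<open>y\<close> depends on \<open>x\<close> alone, so one choice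
  serves every periodic function. It carries statements on the compact box over to the whole
  space.\<close>

lemma box_periodic_reduce:
  fixes a b x :: "real ^ 'n"
  assumes box: "\<And>i. a $ i < b $ i"
  obtains y where "y \<in> cbox a b" "\<And>f::real ^ 'n \<Rightarrow> real. box_periodic a b f \<Longrightarrow> f x = f y"
proof -
  \<comment> \<open>Removing the integer part of the coordinate, measured in periods from the lower
    face, leaves a fraction of one period.\<close>
  define k where "k i = - \<lfloor>(x $ i - a $ i) / (b $ i - a $ i)\<rfloor>" for i
  define y where "y = x + (\<Sum>i\<in>UNIV. of_int (k i) *\<^sub>R axis i (b $ i - a $ i))"
  have red: "f (x + (\<Sum>i\<in>I. of_int (k i) *\<^sub>R axis i (b $ i - a $ i))) = f x"
    if "box_periodic a b f" "finite I" for f :: "real ^ 'n \<Rightarrow> real" and I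
    using that(2)
  proof (induction I rule: finite_induct)
    case (insert i I)
    then show ?case
      using box_periodic_of_int[OF that(1),
          of "x + (\<Sum>i\<in>I. of_int (k i) *\<^sub>R axis i (b $ i - a $ i))" "k i" i]
      by (simp add: algebra_simps)
  qed simp
  have "f x = f y" if "box_periodic a b f" for f :: "real ^ 'n \<Rightarrow> real"
    using red[OF that finite] unfolding y_def by metis
  moreover have "a $ i \<le> y $ i \<and> y $ i \<le> b $ i" for i
  proof -
    define T where "T = b $ i - a $ i"
    have T: "T > 0" using box T_def by simp
    have yi: "y $ i = x $ i + of_int (k i) * T"
      unfolding y_def T_def by (simp add: axis_def if_distrib[of "\<lambda>z. _ * z"] cong: if_cong)
    define q where "q = (x $ i - a $ i) / T"
    have "x $ i = a $ i + q * T" using T by (simp add: q_def)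
    moreover have "k i = - \<lfloor>q\<rfloor>" by (simp add: k_def q_def T_def)
    ultimately have "y $ i - a $ i = (q - of_int \<lfloor>q\<rfloor>) * T" by (simp add: yi algebra_simps)
    moreover have "0 \<le> q - of_int \<lfloor>q\<rfloor>" "q - of_int \<lfloor>q\<rfloor> \<le> 1" by linarith+
    ultimately have "0 \<le> y $ i - a $ i" "y $ i - a $ i \<le> 1 * T"
      using T mult_right_mono[of "q - of_int \<lfloor>q\<rfloor>" 1 T] by auto
    then show ?thesis by (simp add: T_def)
  qed
  ultimately show ?thesis using that[of y] by (auto simp: mem_box_cart)
qed

text \<open>The maximum is global although the functions live on the whole space; each maximum
  principle argument starts at such a point.\<close>

lemma Cinf_attains_max:
  fixes a b :: "real ^ 'n"
  assumes box: "\<And>i. a $ i < b $ i" and f: "f \<in> Cinf a b"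
  obtains x where "\<And>y. f y \<le> f x"
proof -
  have "cbox a b \<noteq> {}" using box less_imp_le by (auto simp: interval_ne_empty_cart)
  then obtain x where x: "\<And>y. y \<in> cbox a b \<Longrightarrow> f y \<le> f x"
    using continuous_attains_sup[OF compact_cbox _ smooth_continuous[OF Cinf_smooth[OF f]]] by blast
  have "f y \<le> f x" for y
    using box_periodic_reduce[OF box, of y] f x by (metis (no_types, lifting) Cinf_def mem_Collect_eq)
  then show ?thesis using that by blast
qed

lemma Cinf_bounded:
  fixes a b :: "real ^ 'n"
  assumes box: "\<And>i. a $ i < b $ i" and f: "f \<in> Cinf a b"
  shows "\<exists>M\<ge>0. \<forall>x. \<bar>f x\<bar> \<le> M"
proof -
  obtain x where x: "\<And>y. f y \<le> f x" using Cinf_attains_max[OF box f] by blast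
  obtain x' where x': "\<And>y. - f y \<le> - f x'" using Cinf_attains_max[OF box Cinf_minus[OF f]] by blast
  have "\<bar>f y\<bar> \<le> \<bar>f x\<bar> + \<bar>f x'\<bar>" for y using x[of y] x'[of y] by linarith
  then show ?thesis by (intro exI[of _ "\<bar>f x\<bar> + \<bar>f x'\<bar>"]) auto
qed

lemma Cinf_pos_lower_bound:
  fixes a b :: "real ^ 'n"
  assumes box: "\<And>i. a $ i < b $ i" and f: "f \<in> Cinf a b" "\<And>x. f x > 0"
  obtains m where "m > 0" "\<And>x. m \<le> f x"
  using Cinf_attains_max[OF box Cinf_minus[OF f(1)]] f(2) by (metis neg_le_iff_le)

subsection \<open>Iterated partial derivatives\<close>

text \<open>Words in the coordinate directions, the head being differentiated last. The order is the
  length of the word, and permuted words are kept apart.\<close>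

definition pderivs :: "'n list \<Rightarrow> (real ^ 'n::finite \<Rightarrow> real) \<Rightarrow> real ^ 'n \<Rightarrow> real" where
  "pderivs is f = foldr partial_deriv is f"

lemma pderivs_simps [simp]:
  "pderivs [] f = f"
  "pderivs (i # is) f = partial_deriv i (pderivs is f)"
  by (simp_all add: pderivs_def)

lemma smooth_pderivs: "smooth f \<Longrightarrow> smooth (pderivs is f)"
  by (induction "is") (auto intro: smooth_partial_deriv)

lemma Cinf_pderivs: "f \<in> Cinf a b \<Longrightarrow> pderivs is f \<in> Cinf a b"
  by (induction "is") (auto intro: Cinf_partial_deriv)

lemma pderivs_differentiable: "smooth f \<Longrightarrow> pderivs is f differentiable (at x)"
  using smooth_pderivs smooth_differentiable by blast

lemma pderivs_const: "pderivs is (\<lambda>x. c) = (\<lambda>x. if is = [] then c else 0)"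
  by (induction "is") auto

lemma pderivs_add:
  assumes "smooth f" "smooth g"
  shows "pderivs is (\<lambda>x. f x + g x) = (\<lambda>x. pderivs is f x + pderivs is g x)"
  by (induction "is") (auto simp: partial_deriv_add pderivs_differentiable assms)

lemma pderivs_cmult:
  assumes "smooth f"
  shows "pderivs is (\<lambda>x. c * f x) = (\<lambda>x. c * pderivs is f x)"
  by (induction "is")
     (auto simp: partial_deriv_mult[of "\<lambda>x. c"] pderivs_differentiable assms)

lemma pderivs_sum:
  assumes "\<And>j. j \<in> J \<Longrightarrow> f j \<in> Cinf a b"
  shows "pderivs is (\<lambda>x. \<Sum>j\<in>J. f j x) = (\<lambda>x. \<Sum>j\<in>J. pderivs is (f j) x)"
  using assms
proof (induction J rule: infinite_finite_induct)
  case (insert j J)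
  then show ?case
    using pderivs_add[of "f j" "\<lambda>x. \<Sum>j\<in>J. f j x" "is"] Cinf_smooth[of _ a b] Cinf_sum[of J f a b]
    by (simp add: Cinf_smooth[of _ a b])
qed (auto simp: pderivs_const)

lemma pderivs_shift:
  assumes "smooth f"
  shows "pderivs is (\<lambda>x. f (x + v)) = (\<lambda>x. pderivs is f (x + v))"
  by (induction "is") (auto simp: partial_deriv_shift pderivs_differentiable assms)

lemma smooth_shift: "smooth f \<Longrightarrow> smooth (\<lambda>x. f (x + v))"
  using Ck_shift smooth_def by blast

section \<open>Leibniz rule modulo lower-order terms\<close>

definition lists_below :: "nat \<Rightarrow> 'n list set" where
  "lists_below s = {ls. length ls < s}"

lemma finite_lists_below [simp]: "finite (lists_below s :: 'n::finite list set)"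
  by (rule finite_subset[OF _ finite_lists_length_le[of "UNIV :: 'n set" s]])
     (auto simp: lists_below_def)

lemma lists_below_mono: "s \<le> s' \<Longrightarrow> lists_below s \<subseteq> lists_below s'"
  by (auto simp: lists_below_def)

text \<open>Linear differential operators of order below \<open>s\<close> with smooth periodic
  coefficients. As a class closed under sums it can hold the remainder of an iterated product rule
  without binomial bookkeeping.\<close>

inductive lower_op ::
    "real ^ 'n::finite \<Rightarrow> real ^ 'n \<Rightarrow> nat \<Rightarrow> ((real ^ 'n \<Rightarrow> real) \<Rightarrow> real ^ 'n \<Rightarrow> real) \<Rightarrow> bool"
  for a b s where
  zero: "lower_op a b s (\<lambda>\<psi> x. 0)"
| mult: "\<alpha> \<in> Cinf a b \<Longrightarrow> length ls < s \<Longrightarrow> lower_op a b s (\<lambda>\<psi> x. \<alpha> x * pderivs ls \<psi> x)"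
| add: "lower_op a b s P \<Longrightarrow> lower_op a b s Q \<Longrightarrow> lower_op a b s (\<lambda>\<psi> x. P \<psi> x + Q \<psi> x)"

text \<open>Differentiability of \<open>P \<psi>\<close> is carried along because the sum rule for
  the next derivative asks for it.\<close>

lemma lower_op_partial_deriv:
  assumes "lower_op a b s P"
  shows "\<exists>Q. lower_op a b (Suc s) Q \<and> (\<forall>\<psi>. smooth \<psi> \<longrightarrow>
           (\<forall>x. P \<psi> differentiable (at x)) \<and> partial_deriv i (P \<psi>) = Q \<psi>)"
  using assms
proof induction
  case zero
  then show ?case by (auto intro!: exI[of _ "\<lambda>\<psi> x. 0"] lower_op.zero)
next
  case (mult \<alpha> ls)
  let ?Q = "\<lambda>\<psi> x. partial_deriv i \<alpha> x * pderivs ls \<psi> x + \<alpha> x * pderivs (i # ls) \<psi> x"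
  have "lower_op a b (Suc s) ?Q"
    using mult by (intro lower_op.add lower_op.mult) (auto intro: Cinf_partial_deriv)
  moreover have "\<alpha> differentiable (at x)" for x
    using mult Cinf_smooth smooth_differentiable by blast
  ultimately show ?case
    by (intro exI[of _ ?Q]) (auto simp: partial_deriv_mult pderivs_differentiable)
next
  case (add P P')
  then obtain Q Q' where
    "lower_op a b (Suc s) Q" "\<And>\<psi>. smooth \<psi> \<Longrightarrow> partial_deriv i (P \<psi>) = Q \<psi>"
    "lower_op a b (Suc s) Q'" "\<And>\<psi>. smooth \<psi> \<Longrightarrow> partial_deriv i (P' \<psi>) = Q' \<psi>"
    and "\<And>\<psi> x. smooth \<psi> \<Longrightarrow> P \<psi> differentiable (at x) \<and> P' \<psi> differentiable (at x)"
    by blast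
  then show ?case
    by (intro exI[of _ "\<lambda>\<psi> x. Q \<psi> x + Q' \<psi> x"])
       (auto intro!: lower_op.add simp: partial_deriv_add)
qed

text \<open>The remainder collects the terms in which at least one derivative falls on
  \<open>\<beta>\<close>. It is chosen before \<open>\<psi>\<close>, so that one constant can later
  serve all translates, all difference quotients and all step sizes.\<close>

lemma pderivs_mult:
  assumes "\<beta> \<in> Cinf a b"
  shows "\<exists>P. lower_op a b (length is) P \<and>
    (\<forall>\<psi>. smooth \<psi> \<longrightarrow> pderivs is (\<lambda>x. \<beta> x * \<psi> x) = (\<lambda>x. \<beta> x * pderivs is \<psi> x + P \<psi> x))"
proof (induction "is")
  case Nil
  show ?case by (auto intro!: exI[of _ "\<lambda>\<psi> x. 0"] lower_op.zero)
next
  case (Cons i "is")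
  then obtain P where P: "lower_op a b (length is) P"
    "\<And>\<psi>. smooth \<psi> \<Longrightarrow> pderivs is (\<lambda>x. \<beta> x * \<psi> x) = (\<lambda>x. \<beta> x * pderivs is \<psi> x + P \<psi> x)"
    by blast
  obtain Q where Q: "lower_op a b (Suc (length is)) Q"
    "\<And>\<psi> x. smooth \<psi> \<Longrightarrow> P \<psi> differentiable (at x)"
    "\<And>\<psi>. smooth \<psi> \<Longrightarrow> partial_deriv i (P \<psi>) = Q \<psi>"
    using lower_op_partial_deriv[OF P(1)] by metis
  let ?R = "\<lambda>\<psi> x. partial_deriv i \<beta> x * pderivs is \<psi> x + Q \<psi> x"
  have \<beta>: "\<beta> differentiable (at x)" for x
    using assms Cinf_smooth smooth_differentiable by blast
  have "lower_op a b (length (i # is)) ?R"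
    using Q(1) assms by (auto intro!: lower_op.add lower_op.mult Cinf_partial_deriv)
  moreover have "pderivs (i # is) (\<lambda>x. \<beta> x * \<psi> x) = (\<lambda>x. \<beta> x * pderivs (i # is) \<psi> x + ?R \<psi> x)"
    if "smooth \<psi>" for \<psi>
    using \<beta> pderivs_differentiable[OF that] Q(2)[OF that]
    by (auto simp: P(2)[OF that] Q(3)[OF that, symmetric] partial_deriv_add partial_deriv_mult)
  ultimately show ?case by blast
qed

lemma lower_op_bound:
  fixes a b :: "real ^ 'n"
  assumes box: "\<And>i. a $ i < b $ i" and "lower_op a b s P"
  shows "\<exists>C\<ge>0. \<forall>\<psi> x. \<bar>P \<psi> x\<bar> \<le> C * (\<Sum>ls\<in>lists_below s. \<bar>pderivs ls \<psi> x\<bar>)"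
  using assms(2)
proof induction
  case zero
  then show ?case by (auto intro!: exI[of _ 0])
next
  case (mult \<alpha> ls)
  obtain M where M: "M \<ge> 0" "\<And>x. \<bar>\<alpha> x\<bar> \<le> M" using Cinf_bounded[OF box mult(1)] by blast
  have "\<bar>\<alpha> x * pderivs ls \<psi> x\<bar> \<le> M * (\<Sum>ls\<in>lists_below s. \<bar>pderivs ls \<psi> x\<bar>)" for \<psi> x
  proof -
    have "ls \<in> lists_below s" using mult(2) by (simp add: lists_below_def)
    then have "\<bar>pderivs ls \<psi> x\<bar> \<le> (\<Sum>ls\<in>lists_below s. \<bar>pderivs ls \<psi> x\<bar>)"
      using member_le_sum[of ls "lists_below s" "\<lambda>ls. \<bar>pderivs ls \<psi> x\<bar>"] by simp
    then show ?thesis unfolding abs_mult using M by (intro mult_mono) auto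
  qed
  then show ?case using M(1) by blast
next
  case (add P Q)
  then obtain C C' where "C \<ge> 0" "C' \<ge> 0"
    "\<And>\<psi> x. \<bar>P \<psi> x\<bar> \<le> C * (\<Sum>ls\<in>lists_below s. \<bar>pderivs ls \<psi> x\<bar>)"
    "\<And>\<psi> x. \<bar>Q \<psi> x\<bar> \<le> C' * (\<Sum>ls\<in>lists_below s. \<bar>pderivs ls \<psi> x\<bar>)" by metis
  then have "\<bar>P \<psi> x + Q \<psi> x\<bar> \<le> (C + C') * (\<Sum>ls\<in>lists_below s. \<bar>pderivs ls \<psi> x\<bar>)" for \<psi> x
    unfolding distrib_right by (intro order_trans[OF abs_triangle_ineq] add_mono) auto
  then show ?case using \<open>C \<ge> 0\<close> \<open>C' \<ge> 0\<close> by (intro exI[of _ "C + C'"]) auto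
qed

lemma pderivs_mult_bound:
  fixes a b :: "real ^ 'n"
  assumes box: "\<And>i. a $ i < b $ i" and "\<beta> \<in> Cinf a b"
  shows "\<exists>C\<ge>0. \<forall>\<psi> x. smooth \<psi> \<longrightarrow>
    \<bar>pderivs is (\<lambda>x. \<beta> x * \<psi> x) x - \<beta> x * pderivs is \<psi> x\<bar>
      \<le> C * (\<Sum>ls\<in>lists_below (length is). \<bar>pderivs ls \<psi> x\<bar>)"
proof -
  obtain P where P: "lower_op a b (length is) P"
    "\<And>\<psi>. smooth \<psi> \<Longrightarrow> pderivs is (\<lambda>x. \<beta> x * \<psi> x) = (\<lambda>x. \<beta> x * pderivs is \<psi> x + P \<psi> x)"
    using pderivs_mult[OF assms(2)] by blast
  then show ?thesis using lower_op_bound[OF box P(1)] by auto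
qed

subsection \<open>Limits of smooth periodic functions\<close>

lemma partial_deriv_mvt:
  fixes f :: "real ^ 'n \<Rightarrow> real"
  assumes "smooth f" "\<delta> > 0"
  obtains \<xi> where "0 < \<xi>" "\<xi> < \<delta>"
    "f (x + \<delta> *\<^sub>R axis i 1) - f x = \<delta> * partial_deriv i f (x + \<xi> *\<^sub>R axis i 1)"
proof -
  have "\<exists>\<xi>. 0 < \<xi> \<and> \<xi> < \<delta> \<and>
     f (x + \<delta> *\<^sub>R axis i 1) - f (x + 0 *\<^sub>R axis i 1) = (\<delta> - 0) * partial_deriv i f (x + \<xi> *\<^sub>R axis i 1)"
    using assms(2) by (intro MVT2 partial_deriv_line smooth_differentiable assms(1)) auto
  then show ?thesis using that by auto
qed

lemma partial_deriv_increment: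
  fixes f :: "real ^ 'n \<Rightarrow> real"
  assumes "smooth f" "\<delta> \<ge> 0" "\<And>x. \<bar>partial_deriv i f x\<bar> \<le> B"
  shows "\<bar>f (x + \<delta> *\<^sub>R axis i 1) - f x\<bar> \<le> \<delta> * B"
proof (cases "\<delta> = 0")
  case False
  then obtain \<xi> where "f (x + \<delta> *\<^sub>R axis i 1) - f x = \<delta> * partial_deriv i f (x + \<xi> *\<^sub>R axis i 1)"
    using partial_deriv_mvt[OF assms(1), of \<delta>] assms(2) by (metis less_eq_real_def)
  then show ?thesis using assms(2,3) by (simp add: abs_mult mult_left_mono)
qed simp

text \<open>At some point within \<open>\<delta>\<close> the derivative equals a difference quotient
  of size at most \<open>2 * A / \<delta>\<close>; going back to \<open>x\<close> costs at most
  \<open>\<delta> * B\<close>. The free \<open>\<delta>\<close> trades smallness of \<open>f\<close>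
  against a mere bound on the second derivative.\<close>

lemma partial_deriv_interpolation:
  fixes f :: "real ^ 'n \<Rightarrow> real"
  assumes sm: "smooth f" and "\<delta> > 0" and A: "\<And>x. \<bar>f x\<bar> \<le> A"
    and B: "\<And>x. \<bar>partial_deriv i (partial_deriv i f) x\<bar> \<le> B"
  shows "\<bar>partial_deriv i f x\<bar> \<le> 2 * A / \<delta> + \<delta> * B"
proof -
  obtain \<xi> where \<xi>: "0 < \<xi>" "\<xi> < \<delta>"
    "f (x + \<delta> *\<^sub>R axis i 1) - f x = \<delta> * partial_deriv i f (x + \<xi> *\<^sub>R axis i 1)"
    using partial_deriv_mvt[OF sm \<open>\<delta> > 0\<close>] by blast
  have "\<bar>partial_deriv i f (x + \<xi> *\<^sub>R axis i 1) - partial_deriv i f x\<bar> \<le> \<xi> * B"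
    using \<xi> by (intro partial_deriv_increment B smooth_partial_deriv sm) auto
  moreover have "\<xi> * B \<le> \<delta> * B" using \<xi> B[of x] by (intro mult_right_mono) auto
  moreover have "\<bar>partial_deriv i f (x + \<xi> *\<^sub>R axis i 1)\<bar> \<le> 2 * A / \<delta>"
  proof -
    have "partial_deriv i f (x + \<xi> *\<^sub>R axis i 1) = (f (x + \<delta> *\<^sub>R axis i 1) - f x) / \<delta>"
      using \<xi>(3) \<open>\<delta> > 0\<close> by simp
    moreover have "\<bar>f (x + \<delta> *\<^sub>R axis i 1) - f x\<bar> \<le> 2 * A"
      using A[of x] A[of "x + \<delta> *\<^sub>R axis i 1"] by linarith
    ultimately show ?thesis using \<open>\<delta> > 0\<close> by (simp add: divide_right_mono)
  qed
  ultimately show ?thesis by linarith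
qed

lemma uniformly_Cauchy_partial_deriv:
  fixes \<phi> :: "nat \<Rightarrow> real ^ 'n \<Rightarrow> real"
  assumes sm: "\<And>k. smooth (\<phi> k)" and C: "uniformly_Cauchy_on UNIV \<phi>"
    and B: "\<And>k x. \<bar>partial_deriv i (partial_deriv i (\<phi> k)) x\<bar> \<le> B"
  shows "uniformly_Cauchy_on UNIV (\<lambda>k. partial_deriv i (\<phi> k))"
proof (rule uniformly_Cauchy_onI)
  fix e :: real assume "e > 0"
  \<comment> \<open>Second derivatives of a difference of two members are bounded by
    \<open>2 * B\<close>; with this \<open>\<delta>\<close> their share is below
    \<open>e / 2\<close>. The sup distance \<open>e * \<delta> / 8\<close> required afterwards
    contributes \<open>e / 4\<close>.\<close>
  define \<delta> where "\<delta> = e / (4 * (B + 1))"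
  have "B \<ge> 0" using B[of 0 0] by linarith
  then have \<delta>: "\<delta> > 0" "\<delta> * (2 * B) < e / 2 + e / 4" using \<open>e > 0\<close>
    using mult_nonneg_nonneg[of B e] by (auto simp: \<delta>_def field_simps intro: add_pos_nonneg)
  have "e * \<delta> / 8 > 0" using \<open>e > 0\<close> \<delta> by simp
  then obtain N where N: "\<And>x m n. m \<ge> N \<Longrightarrow> n \<ge> N \<Longrightarrow> dist (\<phi> m x) (\<phi> n x) < e * \<delta> / 8"
    using C unfolding uniformly_Cauchy_on_def by (metis UNIV_I)
  have "dist (partial_deriv i (\<phi> m) x) (partial_deriv i (\<phi> n) x) < e" if "m \<ge> N" "n \<ge> N" for m n x
  proof -
    define f where "f = (\<lambda>x. \<phi> m x + - 1 * \<phi> n x)"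
    have sf: "smooth f" using sm unfolding f_def smooth_def by (intro allI Ck_add Ck_mult Ck_const) auto
    have smn: "smooth (\<lambda>x. - 1 * \<phi> n x)"
      using sm unfolding smooth_def by (intro allI Ck_mult Ck_const) auto
    have d: "pderivs is f x = pderivs is (\<phi> m) x - pderivs is (\<phi> n) x" for "is" x
      unfolding f_def pderivs_add[OF sm smn] pderivs_cmult[OF sm] by simp
    have "\<bar>partial_deriv i f x\<bar> \<le> 2 * (e * \<delta> / 8) / \<delta> + \<delta> * (2 * B)"
    proof (rule partial_deriv_interpolation[OF sf \<delta>(1)])
      show "\<bar>f y\<bar> \<le> e * \<delta> / 8" for y
        using N[OF that, of y] by (simp add: f_def dist_real_def)
      show "\<bar>partial_deriv i (partial_deriv i f) y\<bar> \<le> 2 * B" for y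
        using d[of "[i, i]" y] B[of m y] B[of n y] by simp
    qed
    also have "\<dots> < e" using \<delta> by simp
    finally show ?thesis using d[of "[i]" x] by (simp add: dist_real_def)
  qed
  then show "\<exists>M. \<forall>x\<in>UNIV. \<forall>m\<ge>M. \<forall>n\<ge>M.
      dist (partial_deriv i (\<phi> m) x) (partial_deriv i (\<phi> n) x) < e" by blast
qed

lemma partial_deriv_limit:
  fixes \<phi> :: "nat \<Rightarrow> real ^ 'n \<Rightarrow> real"
  assumes sm: "\<And>k. smooth (\<phi> k)" and \<psi>: "\<And>x. (\<lambda>k. \<phi> k x) \<longlonglongrightarrow> \<psi> x"
    and \<psi>': "\<And>i. uniform_limit UNIV (\<lambda>k. partial_deriv i (\<phi> k)) (\<psi>' i) sequentially"
  shows "\<psi> differentiable (at x)" and "partial_deriv i \<psi> x = \<psi>' i x"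
proof -
  have "\<exists>g. \<forall>x\<in>UNIV. (\<lambda>k. \<phi> k x) \<longlonglongrightarrow> g x \<and>
      (g has_derivative (\<lambda>h. \<Sum>i\<in>UNIV. \<psi>' i x * h $ i)) (at x within UNIV)"
  proof (rule has_derivative_sequence[where ?x0.0=0 and f' = "\<lambda>k x h. \<Sum>i\<in>UNIV. partial_deriv i (\<phi> k) x * h $ i"])
    show "(\<phi> n has_derivative (\<lambda>h. \<Sum>i\<in>UNIV. partial_deriv i (\<phi> n) x * h $ i)) (at x within UNIV)" for n x
      using has_derivative_gradient[OF smooth_differentiable[OF sm]] by simp
    show "(\<lambda>n. \<phi> n 0) \<longlonglongrightarrow> \<psi> 0" by (rule \<psi>)
    fix e :: real assume "e > 0"
    \<comment> \<open>A linear functional whose coefficients are below \<open>e'\<close> has norm at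
      most \<open>e\<close>, one \<open>e'\<close> for each coordinate.\<close>
    define e' where "e' = e / real CARD('n)"
    have "e' > 0" using \<open>e > 0\<close> by (simp add: e'_def)
    then have "\<forall>\<^sub>F n in sequentially. \<forall>i. \<forall>x. dist (partial_deriv i (\<phi> n) x) (\<psi>' i x) < e'"
      using \<psi>' unfolding uniform_limit_iff by (intro eventually_all_finite) simp
    then show "\<forall>\<^sub>F n in sequentially. \<forall>x\<in>UNIV. \<forall>h.
        norm ((\<Sum>i\<in>UNIV. partial_deriv i (\<phi> n) x * h $ i) - (\<Sum>i\<in>UNIV. \<psi>' i x * h $ i)) \<le> e * norm h"
    proof eventually_elim
      case (elim n)
      show ?case
      proof (intro ballI allI)
        fix x h :: "real ^ 'n"
        have "norm ((\<Sum>i\<in>UNIV. partial_deriv i (\<phi> n) x * h $ i) - (\<Sum>i\<in>UNIV. \<psi>' i x * h $ i))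
            = \<bar>\<Sum>i\<in>UNIV. (partial_deriv i (\<phi> n) x - \<psi>' i x) * h $ i\<bar>"
          by (simp add: sum_subtractf left_diff_distrib)
        also have "\<dots> \<le> (\<Sum>i\<in>UNIV. \<bar>(partial_deriv i (\<phi> n) x - \<psi>' i x) * h $ i\<bar>)" by (rule sum_abs)
        also have "\<dots> \<le> (\<Sum>i\<in>(UNIV::'n set). e' * norm h)"
          unfolding abs_mult using elim \<open>e' > 0\<close>
          by (intro sum_mono mult_mono component_le_norm_cart)
             (auto simp: dist_real_def less_imp_le)
        also have "\<dots> = e * norm h" by (simp add: e'_def)
        finally show "norm ((\<Sum>i\<in>UNIV. partial_deriv i (\<phi> n) x * h $ i) - (\<Sum>i\<in>UNIV. \<psi>' i x * h $ i))
          \<le> e * norm h" .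
      qed
    qed
  qed auto
  then obtain g where g: "\<And>x. (\<lambda>k. \<phi> k x) \<longlonglongrightarrow> g x"
    "\<And>x. (g has_derivative (\<lambda>h. \<Sum>i\<in>UNIV. \<psi>' i x * h $ i)) (at x)" by auto
  have "g = \<psi>" using LIMSEQ_unique[OF g(1) \<psi>] by blast
  then have D: "(\<psi> has_derivative (\<lambda>h. \<Sum>i\<in>UNIV. \<psi>' i x * h $ i)) (at x)" using g(2) by blast
  then show "\<psi> differentiable (at x)" using differentiable_def by blast
  show "partial_deriv i \<psi> x = \<psi>' i x"
    using partial_deriv_eq[OF D] by (simp add: axis_def if_distrib[of "\<lambda>z. _ * z"] cong: if_cong)
qed

text \<open>Interpolating between the Cauchy property at \<open>is\<close> and the bound at
  \<open>i # i # is\<close> yields the Cauchy property at \<open>i # is\<close>; bounds at all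
  orders keep this induction going.\<close>

lemma Cinf_limit:
  fixes \<phi> :: "nat \<Rightarrow> real ^ 'n \<Rightarrow> real"
  assumes \<phi>: "\<And>k. \<phi> k \<in> Cinf a b" and C: "uniformly_Cauchy_on UNIV \<phi>"
    and B: "\<And>is. \<exists>M. \<forall>k x. \<bar>pderivs is (\<phi> k) x\<bar> \<le> M"
  obtains \<psi> where "\<psi> \<in> Cinf a b"
    "\<And>is. uniform_limit UNIV (\<lambda>k. pderivs is (\<phi> k)) (pderivs is \<psi>) sequentially"
proof -
  have sm: "smooth (pderivs is (\<phi> k))" for "is" k
    using \<phi> Cinf_smooth smooth_pderivs by blast
  have "uniformly_Cauchy_on UNIV (\<lambda>k. pderivs is (\<phi> k))" for "is"
  proof (induction "is")
    case Nil
    then show ?case using C by simp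
  next
    case (Cons i "is")
    obtain M where "\<And>k x. \<bar>pderivs (i # i # is) (\<phi> k) x\<bar> \<le> M" using B by blast
    then show ?case using uniformly_Cauchy_partial_deriv[OF sm Cons.IH, of i M] by simp
  qed
  then have "\<forall>is. \<exists>l. uniform_limit UNIV (\<lambda>k. pderivs is (\<phi> k)) l sequentially"
    using Cauchy_uniformly_convergent uniformly_convergent_on_def by blast
  \<comment> \<open>The limits for all words are fixed together. Each \<open>l (i # is)\<close>
    turns out to be the derivative of \<open>l is\<close>, so smoothness is an induction over all
    words simultaneously.\<close>
  then obtain l where l: "\<And>is. uniform_limit UNIV (\<lambda>k. pderivs is (\<phi> k)) (l is) sequentially" by metis
  have pt: "(\<lambda>k. pderivs is (\<phi> k) x) \<longlonglongrightarrow> l is x" for "is" x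
    using tendsto_uniform_limitI[OF l] by blast
  have ld: "l is differentiable (at x)" "partial_deriv i (l is) x = l (i # is) x" for "is" x i
    using partial_deriv_limit[of "\<lambda>k. pderivs is (\<phi> k)" "l is" "\<lambda>i. l (i # is)", OF sm pt] l[of "_ # is"]
    by auto
  have "Ck k (l is)" for k "is"
  proof (induction k arbitrary: "is")
    case 0
    then show ?case
      using ld by (auto intro!: continuous_at_imp_continuous_on differentiable_imp_continuous_within)
  next
    case (Suc k)
    have "partial_deriv i (l is) = l (i # is)" for i using ld by blast
    then show ?case using Suc ld by simp
  qed
  moreover have "box_periodic a b (l [])"
    unfolding box_periodic_def
  proof (intro allI)
    fix i x
    have "(\<lambda>k. \<phi> k (x + axis i (b $ i - a $ i))) = (\<lambda>k. \<phi> k x)"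
      using \<phi> by (auto simp: Cinf_def box_periodic_def)
    then show "l [] (x + axis i (b $ i - a $ i)) = l [] x"
      using LIMSEQ_unique[of "\<lambda>k. \<phi> k x"] pt[of "[]" x]
        pt[of "[]" "x + axis i (b $ i - a $ i)"] by simp
  qed
  moreover have "pderivs is (l []) = l is" for "is"
    by (induction "is") (auto simp: ld)
  ultimately show ?thesis using that[of "l []"] l by (simp add: Cinf_def smooth_def)
qed

subsection \<open>A contraction built from shifts\<close>

text \<open>The contraction itself gives uniform convergence of the iterates. For smoothness of the
  limit each derivative of the iterates is bounded: the top-order part of the differentiated
  recursion is contracted by the same \<open>\<theta>\<close>, and the rest is of lower order. The
  bounds depend on the coefficients, so they serve existence at a fixed step and not the limit of
  vanishing step.\<close>

lemma shift_fixed_point: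
  fixes a b :: "real ^ 'n" and v :: "'j \<Rightarrow> real ^ 'n"
  assumes box: "\<And>i. a $ i < b $ i" and J: "finite J"
    and \<alpha>: "\<And>j. j \<in> J \<Longrightarrow> \<alpha> j \<in> Cinf a b" "\<And>j x. j \<in> J \<Longrightarrow> \<alpha> j x \<ge> 0"
    and \<theta>: "\<And>x. (\<Sum>j\<in>J. \<alpha> j x) \<le> \<theta>" "0 \<le> \<theta>" "\<theta> < 1"
    and g: "g \<in> Cinf a b"
  shows "\<exists>\<phi>\<in>Cinf a b. \<forall>x. \<phi> x = g x + (\<Sum>j\<in>J. \<alpha> j x * \<phi> (x + v j))"
proof -
  define T where "T \<phi> x = g x + (\<Sum>j\<in>J. \<alpha> j x * \<phi> (x + v j))" for \<phi> :: "real ^ 'n \<Rightarrow> real" and x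
  define \<phi> where "\<phi> k = (T ^^ k) (\<lambda>x. 0)" for k
  have \<phi>0: "\<phi> 0 = (\<lambda>x. 0)" and \<phi>Suc: "\<phi> (Suc k) = T (\<phi> k)" for k by (simp_all add: \<phi>_def)
  \<comment> \<open>Nonnegative weights of total at most \<open>\<theta>\<close> shrink a sup bound
    by \<open>\<theta>\<close>, whatever the translations are.\<close>
  have avg: "\<bar>\<Sum>j\<in>J. \<alpha> j x * f (x + v j)\<bar> \<le> \<theta> * M" if "\<And>x. \<bar>f x\<bar> \<le> M" for f M x
  proof -
    have "\<bar>\<Sum>j\<in>J. \<alpha> j x * f (x + v j)\<bar> \<le> (\<Sum>j\<in>J. \<alpha> j x * M)"
      using that \<alpha>(2) by (intro order_trans[OF sum_abs] sum_mono) (auto simp: abs_mult mult_left_mono)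
    also have "\<dots> \<le> \<theta> * M"
      using \<theta>(1)[of x] that[of x] by (simp add: sum_distrib_right[symmetric] mult_right_mono)
    finally show ?thesis .
  qed
  have \<phi>C: "\<phi> k \<in> Cinf a b" for k
  proof (induction k)
    case 0
    then show ?case by (simp add: \<phi>0 Cinf_const)
  next
    case (Suc k)
    then show ?case unfolding \<phi>Suc T_def
      using g \<alpha> by (intro Cinf_add Cinf_sum Cinf_mult Cinf_shift) auto
  qed
  obtain B where B: "B \<ge> 0" "\<And>x. \<bar>g x\<bar> \<le> B" using Cinf_bounded[OF box g] by blast
  have step: "\<bar>\<phi> (Suc k) x - \<phi> k x\<bar> \<le> B * \<theta> ^ k" for k x
  proof (induction k arbitrary: x)
    case 0
    then show ?case using B by (simp add: \<phi>Suc \<phi>0 T_def)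
  next
    case (Suc k)
    have "\<phi> (Suc (Suc k)) x - \<phi> (Suc k) x = (\<Sum>j\<in>J. \<alpha> j x * (\<phi> (Suc k) (x + v j) - \<phi> k (x + v j)))"
      by (simp add: \<phi>Suc T_def sum_subtractf right_diff_distrib)
    then show ?case using avg[of "\<lambda>x. \<phi> (Suc k) x - \<phi> k x", OF Suc] by (simp add: ac_simps)
  qed
  \<comment> \<open>The increments are dominated by a geometric series and telescope to the
    iterates.\<close>
  have "uniformly_convergent_on UNIV (\<lambda>n x. \<Sum>k<n. \<phi> (Suc k) x - \<phi> k x)"
    using step \<theta> by (intro Weierstrass_m_test'[where M="\<lambda>k. B * \<theta> ^ k"] summable_mult summable_geometric) auto
  moreover have "(\<Sum>k<n. \<phi> (Suc k) x - \<phi> k x) = \<phi> n x" for n x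
    by (subst sum_lessThan_telescope[of "\<lambda>k. \<phi> k x"]) (simp add: \<phi>0)
  ultimately have cauchy: "uniformly_Cauchy_on UNIV \<phi>"
    using uniformly_convergent_Cauchy by simp
  have bound: "\<exists>M. \<forall>k x. \<bar>pderivs is (\<phi> k) x\<bar> \<le> M" for "is"
  proof (induction "is" rule: measure_induct_rule[of length])
    case (less "is")
    then have "\<forall>ls\<in>lists_below (length is). \<exists>M. \<forall>k x. \<bar>pderivs ls (\<phi> k) x\<bar> \<le> M"
      by (simp add: lists_below_def)
    from bchoice[OF this] obtain M where
      M': "\<forall>ls\<in>lists_below (length is). \<forall>k x. \<bar>pderivs ls (\<phi> k) x\<bar> \<le> M ls" ..
    have M: "\<bar>pderivs ls (\<phi> k) x\<bar> \<le> M ls" if "ls \<in> lists_below (length is)" for ls k x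
      using M' that by simp
    define L where "L = (\<Sum>ls\<in>lists_below (length is). M ls)"
    have "\<forall>j\<in>J. \<exists>C\<ge>0. \<forall>\<psi> x. smooth \<psi> \<longrightarrow>
        \<bar>pderivs is (\<lambda>x. \<alpha> j x * \<psi> x) x - \<alpha> j x * pderivs is \<psi> x\<bar>
          \<le> C * (\<Sum>ls\<in>lists_below (length is). \<bar>pderivs ls \<psi> x\<bar>)"
      using pderivs_mult_bound[OF box \<alpha>(1)] by simp
    from bchoice[OF this] obtain C where
      C': "\<forall>j\<in>J. 0 \<le> C j \<and> (\<forall>\<psi> x. smooth \<psi> \<longrightarrow>
        \<bar>pderivs is (\<lambda>x. \<alpha> j x * \<psi> x) x - \<alpha> j x * pderivs is \<psi> x\<bar>
          \<le> C j * (\<Sum>ls\<in>lists_below (length is). \<bar>pderivs ls \<psi> x\<bar>))" ..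
    have C: "j \<in> J \<Longrightarrow> C j \<ge> 0"
      "j \<in> J \<Longrightarrow> smooth \<psi> \<Longrightarrow> \<bar>pderivs is (\<lambda>x. \<alpha> j x * \<psi> x) x - \<alpha> j x * pderivs is \<psi> x\<bar>
        \<le> C j * (\<Sum>ls\<in>lists_below (length is). \<bar>pderivs ls \<psi> x\<bar>)" for j \<psi> x
      using C' by simp_all
    obtain G where G: "\<And>x. \<bar>pderivs is g x\<bar> \<le> G" using Cinf_bounded[OF box Cinf_pderivs[OF g]] by blast
    define K where "K = G + (\<Sum>j\<in>J. C j * L)"
    \<comment> \<open>Solution of \<open>K + \<theta> * M' = M'\<close>: a bound by
      \<open>M'\<close> reproduces itself from one iterate to the next.\<close>
    define M' where "M' = K / (1 - \<theta>)"
    have M'eq: "K + \<theta> * M' = M'" using \<theta> by (simp add: M'_def field_simps)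
    have "\<bar>pderivs is (\<phi> k) x\<bar> \<le> M'" for k x
    proof (induction k arbitrary: x)
      case 0
      have "\<forall>ls\<in>lists_below (length is). 0 \<le> M ls" using M[of _ 0 0] by (meson abs_ge_zero order_trans)
      then have "L \<ge> 0" unfolding L_def by (simp add: sum_nonneg)
      moreover have "G \<ge> 0" using G[of 0] by linarith
      ultimately have "M' \<ge> 0" unfolding M'_def K_def using C(1) \<theta> by (simp add: sum_nonneg)
      then show ?case by (simp add: \<phi>0 pderivs_const)
    next
      case (Suc k)
      define \<psi> where "\<psi> j y = \<phi> k (y + v j)" for j y
      have \<psi>C: "\<psi> j \<in> Cinf a b" for j unfolding \<psi>_def using \<phi>C Cinf_shift by blast
      have s\<psi>: "smooth (\<psi> j)" for j using \<psi>C Cinf_smooth by blast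
      have \<alpha>\<psi>C: "(\<lambda>x. \<Sum>j\<in>J. \<alpha> j x * \<psi> j x) \<in> Cinf a b"
        using \<alpha>(1) \<psi>C by (intro Cinf_sum Cinf_mult)
      have p\<psi>: "pderivs ls (\<psi> j) y = pderivs ls (\<phi> k) (y + v j)" for ls j y
        unfolding \<psi>_def using pderivs_shift[OF Cinf_smooth[OF \<phi>C]] by metis
      have T: "T (\<phi> k) = (\<lambda>x. g x + (\<Sum>j\<in>J. \<alpha> j x * \<psi> j x))" by (auto simp: T_def \<psi>_def)
      have "pderivs is (\<phi> (Suc k)) x = pderivs is g x + (\<Sum>j\<in>J. pderivs is (\<lambda>x. \<alpha> j x * \<psi> j x) x)"
        unfolding \<phi>Suc T pderivs_add[OF Cinf_smooth[OF g] Cinf_smooth[OF \<alpha>\<psi>C]]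
        using \<alpha>(1) \<psi>C by (subst pderivs_sum[where a=a and b=b]) (auto intro: Cinf_mult)
      \<comment> \<open>Splitting off the Leibniz remainders leaves as last sum a weighted average
        of the same derivative of the previous iterate.\<close>
      also have "\<dots> = pderivs is g x
          + (\<Sum>j\<in>J. pderivs is (\<lambda>x. \<alpha> j x * \<psi> j x) x - \<alpha> j x * pderivs is (\<psi> j) x)
          + (\<Sum>j\<in>J. \<alpha> j x * pderivs is (\<phi> k) (x + v j))"
        by (simp add: sum_subtractf p\<psi>)
      finally have eq: "pderivs is (\<phi> (Suc k)) x = \<dots>" .
      have "\<bar>\<Sum>j\<in>J. pderivs is (\<lambda>x. \<alpha> j x * \<psi> j x) x - \<alpha> j x * pderivs is (\<psi> j) x\<bar> \<le> (\<Sum>j\<in>J. C j * L)"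
      proof (intro order_trans[OF sum_abs] sum_mono)
        fix j assume j: "j \<in> J"
        have "(\<Sum>ls\<in>lists_below (length is). \<bar>pderivs ls (\<psi> j) x\<bar>) \<le> L"
          unfolding L_def p\<psi> by (intro sum_mono M)
        then show "\<bar>pderivs is (\<lambda>x. \<alpha> j x * \<psi> j x) x - \<alpha> j x * pderivs is (\<psi> j) x\<bar> \<le> C j * L"
          using C(2)[OF j s\<psi>] C(1)[OF j] mult_left_mono order_trans by meson
      qed
      then have "\<bar>pderivs is (\<phi> (Suc k)) x\<bar> \<le> K + \<theta> * M'"
        unfolding eq K_def using G[of x] avg[of "pderivs is (\<phi> k)" M', OF Suc, of x] by linarith
      then show ?case using M'eq by simp
    qed
    then show ?case by blast
  qed
  obtain \<psi> where \<psi>: "\<psi> \<in> Cinf a b"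
    "\<And>is. uniform_limit UNIV (\<lambda>k. pderivs is (\<phi> k)) (pderivs is \<psi>) sequentially"
    using Cinf_limit[OF \<phi>C cauchy bound] by blast
  have lim: "(\<lambda>k. \<phi> k x) \<longlonglongrightarrow> \<psi> x" for x
    using tendsto_uniform_limitI[OF \<psi>(2)[of "[]"]] by simp
  have "\<psi> x = g x + (\<Sum>j\<in>J. \<alpha> j x * \<psi> (x + v j))" for x
  proof (rule LIMSEQ_unique)
    show "(\<lambda>k. \<phi> (Suc k) x) \<longlonglongrightarrow> \<psi> x" using lim LIMSEQ_Suc by blast
    show "(\<lambda>k. \<phi> (Suc k) x) \<longlonglongrightarrow> g x + (\<Sum>j\<in>J. \<alpha> j x * \<psi> (x + v j))"
      unfolding \<phi>Suc T_def by (intro tendsto_intros lim)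
  qed
  then show ?thesis using \<psi>(1) by blast
qed

subsection \<open>Difference operators\<close>

definition cdiff :: "real \<Rightarrow> 'n \<Rightarrow> (real ^ 'n::finite \<Rightarrow> real) \<Rightarrow> real ^ 'n \<Rightarrow> real" where
  "cdiff h i f x = (f (x + h *\<^sub>R axis i 1) - f (x - h *\<^sub>R axis i 1)) / (2 * h)"

definition sdiff :: "real \<Rightarrow> 'n \<Rightarrow> (real ^ 'n::finite \<Rightarrow> real) \<Rightarrow> real ^ 'n \<Rightarrow> real" where
  "sdiff h i f x = (f (x + h *\<^sub>R axis i 1) + f (x - h *\<^sub>R axis i 1) - 2 * f x) / h\<^sup>2"

text \<open>Difference analogue of minus the Laplacian minus the drift along \<open>\<beta>\<close>.
  The coefficients are evaluated at \<open>x\<close> itself, and the sign makes the operator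
  nonnegative at a maximum when \<open>h\<close> is small.\<close>

definition diffusion ::
    "('n \<Rightarrow> real ^ 'n::finite \<Rightarrow> real) \<Rightarrow> real \<Rightarrow> (real ^ 'n \<Rightarrow> real) \<Rightarrow> real ^ 'n \<Rightarrow> real" where
  "diffusion \<beta> h f x = (\<Sum>i\<in>UNIV. - sdiff h i f x - \<beta> i x * cdiff h i f x)"

lemma Cinf_cdiff: "f \<in> Cinf a b \<Longrightarrow> cdiff h i f \<in> Cinf a b"
  unfolding cdiff_def[abs_def] by (intro Cinf_divide_const Cinf_diff Cinf_shift Cinf_shift')

lemma Cinf_sdiff: "f \<in> Cinf a b \<Longrightarrow> sdiff h i f \<in> Cinf a b"
  unfolding sdiff_def[abs_def]
  by (intro Cinf_divide_const Cinf_diff Cinf_add Cinf_mult Cinf_const Cinf_shift Cinf_shift')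

text \<open>A difference quotient combines translates with constant coefficients, and partial
  derivatives commute with translations.\<close>

lemma pderivs_cdiff:
  assumes "f \<in> Cinf a b"
  shows "pderivs is (cdiff h i f) = cdiff h i (pderivs is f)"
proof -
  have sf: "smooth f" using assms Cinf_smooth by blast
  have s: "smooth (\<lambda>x. f (x + v))" "smooth (\<lambda>x. c * f (x + v))" for v c
    using Cinf_smooth[OF Cinf_shift[OF assms]] Cinf_smooth[OF Cinf_mult[OF Cinf_const Cinf_shift[OF assms]]] .
  have "cdiff h i f = (\<lambda>x. 1 / (2 * h) * f (x + h *\<^sub>R axis i 1) + - 1 / (2 * h) * f (x + - (h *\<^sub>R axis i 1)))"
    by (auto simp: cdiff_def diff_divide_distrib)
  then show ?thesis
    by (simp only: pderivs_add[OF s(2) s(2)] pderivs_cmult[OF s(1)] pderivs_shift[OF sf])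
       (auto simp: cdiff_def diff_divide_distrib)
qed

lemma pderivs_sdiff:
  assumes "f \<in> Cinf a b"
  shows "pderivs is (sdiff h i f) = sdiff h i (pderivs is f)"
proof -
  have sf: "smooth f" using assms Cinf_smooth by blast
  have s: "smooth (\<lambda>x. f (x + v))" "smooth (\<lambda>x. c * f (x + v))" "smooth (\<lambda>x. c * f x)" for v c
    using Cinf_smooth[OF Cinf_shift[OF assms]] Cinf_smooth[OF Cinf_mult[OF Cinf_const Cinf_shift[OF assms]]]
      Cinf_smooth[OF Cinf_mult[OF Cinf_const assms]] .
  have s': "smooth (\<lambda>x. c * f (x + v) + d * f (x + w))" for c d v w
    using assms by (intro Cinf_smooth[of _ a b] Cinf_add Cinf_mult Cinf_const Cinf_shift)
  have "sdiff h i f = (\<lambda>x. 1 / h\<^sup>2 * f (x + h *\<^sub>R axis i 1) + 1 / h\<^sup>2 * f (x + - (h *\<^sub>R axis i 1))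
      + - 2 / h\<^sup>2 * f x)"
    by (auto simp: sdiff_def diff_divide_distrib add_divide_distrib)
  then show ?thesis
    by (simp only: pderivs_add[OF s' s(3)] pderivs_add[OF s(2) s(2)] pderivs_cmult[OF s(1)]
          pderivs_cmult[OF sf] pderivs_shift[OF sf])
       (auto simp: sdiff_def diff_divide_distrib add_divide_distrib)
qed

lemma cdiff_add: "cdiff h i (\<lambda>x. f x + g x) x = cdiff h i f x + cdiff h i g x"
  by (simp add: cdiff_def add_divide_distrib diff_divide_distrib)

lemma sdiff_add: "sdiff h i (\<lambda>x. f x + g x) x = sdiff h i f x + sdiff h i g x"
  by (simp add: sdiff_def add_divide_distrib diff_divide_distrib)

lemma diffusion_add: "diffusion \<beta> h (\<lambda>x. f x + g x) x = diffusion \<beta> h f x + diffusion \<beta> h g x"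
  by (simp add: diffusion_def cdiff_add sdiff_add algebra_simps sum.distrib sum_subtractf sum_negf)

lemma diffusion_cmult: "diffusion \<beta> h (\<lambda>x. c * f x) x = c * diffusion \<beta> h f x"
proof -
  have "cdiff h i (\<lambda>x. c * f x) x = c * cdiff h i f x" for i
    by (simp add: cdiff_def right_diff_distrib)
  moreover have "sdiff h i (\<lambda>x. c * f x) x = c * sdiff h i f x" for i
    by (simp add: sdiff_def algebra_simps)
  ultimately show ?thesis by (simp add: diffusion_def sum_distrib_left algebra_simps)
qed

lemma diffusion_sum: "diffusion \<beta> h (\<lambda>x. \<Sum>j\<in>J. f j x) x = (\<Sum>j\<in>J. diffusion \<beta> h (f j) x)"
proof (induction J rule: infinite_finite_induct)
  case (insert j J)
  then show ?case by (simp add: diffusion_add)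
qed (simp_all add: diffusion_def cdiff_def sdiff_def)

section \<open>Monotone form of the scheme and the discrete maximum principle\<close>

text \<open>Written through \<open>f x\<close> minus its two neighbours, the scheme shows its
  monotonicity: behaviour at a maximum is decided by the signs of the two weights.\<close>

lemma diffusion_weights:
  assumes "h \<noteq> 0"
  shows "- sdiff h i f x - \<beta> * cdiff h i f x
    = (1 / h\<^sup>2 + \<beta> / (2 * h)) * (f x - f (x + h *\<^sub>R axis i 1))
      + (1 / h\<^sup>2 - \<beta> / (2 * h)) * (f x - f (x - h *\<^sub>R axis i 1))"
  using assms by (simp add: sdiff_def cdiff_def field_simps power2_eq_square)

text \<open>At least half of the weight \<open>1 / h\<^sup>2\<close> survives the drift, and this
  half pays for the squared difference in \<open>diffusion_square\<close>.\<close>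

lemma weights_lower_bound:
  assumes "h > 0" "h * \<bar>\<beta>\<bar> \<le> (1::real)"
  shows "1 / (2 * h\<^sup>2) \<le> 1 / h\<^sup>2 + \<beta> / (2 * h)" "1 / (2 * h\<^sup>2) \<le> 1 / h\<^sup>2 - \<beta> / (2 * h)"
proof -
  have "\<bar>h * \<beta>\<bar> \<le> 1" using assms by (simp add: abs_mult)
  then have "-1 \<le> h * \<beta>" "h * \<beta> \<le> 1" by linarith+
  moreover have "1 / h\<^sup>2 + \<beta> / (2 * h) - 1 / (2 * h\<^sup>2) = (1 + h * \<beta>) / (2 * h\<^sup>2)"
    "1 / h\<^sup>2 - \<beta> / (2 * h) - 1 / (2 * h\<^sup>2) = (1 - h * \<beta>) / (2 * h\<^sup>2)"
    using assms(1) by (simp_all add: field_simps power2_eq_square)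
  ultimately have "0 \<le> 1 / h\<^sup>2 + \<beta> / (2 * h) - 1 / (2 * h\<^sup>2)" "0 \<le> 1 / h\<^sup>2 - \<beta> / (2 * h) - 1 / (2 * h\<^sup>2)"
    by simp_all
  then show "1 / (2 * h\<^sup>2) \<le> 1 / h\<^sup>2 + \<beta> / (2 * h)" "1 / (2 * h\<^sup>2) \<le> 1 / h\<^sup>2 - \<beta> / (2 * h)" by linarith+
qed

lemma weights_nonneg:
  assumes "h > 0" "h * \<bar>\<beta>\<bar> \<le> (1::real)"
  shows "0 \<le> 1 / h\<^sup>2 + \<beta> / (2 * h)" "0 \<le> 1 / h\<^sup>2 - \<beta> / (2 * h)"
  using weights_lower_bound[OF assms] by (smt (verit) divide_nonneg_nonneg zero_le_power2)+

lemma diffusion_at_max: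
  assumes h: "h > 0" "\<And>i. h * \<bar>\<beta> i x\<bar> \<le> 1" and "\<And>y. f y \<le> f x"
  shows "diffusion \<beta> h f x \<ge> 0"
  unfolding diffusion_def
proof (rule sum_nonneg)
  fix i
  show "0 \<le> - sdiff h i f x - \<beta> i x * cdiff h i f x"
    using h assms(3) diffusion_weights[of h i f x "\<beta> i x"] weights_nonneg[OF h(1) h(2)[of i]] by simp
qed

text \<open>Discrete counterpart of the rule that minus the Laplacian of \<open>f\<^sup>2\<close> is
  \<open>2 * f\<close> times minus the Laplacian of \<open>f\<close>, less twice the squared
  gradient. A neighbour at difference \<open>p\<close> contributes \<open>- w * p\<^sup>2\<close>;
  the lower bound on the weights turns these terms into the squared centred difference.\<close>

lemma diffusion_square:
  assumes h: "h > 0" "\<And>i. h * \<bar>\<beta> i x\<bar> \<le> 1"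
  shows "diffusion \<beta> h (\<lambda>x. (f x)\<^sup>2) x \<le> 2 * f x * diffusion \<beta> h f x - (\<Sum>i\<in>UNIV. (cdiff h i f x)\<^sup>2)"
proof -
  have "- sdiff h i (\<lambda>x. (f x)\<^sup>2) x - \<beta> i x * cdiff h i (\<lambda>x. (f x)\<^sup>2) x
      \<le> 2 * f x * (- sdiff h i f x - \<beta> i x * cdiff h i f x) - (cdiff h i f x)\<^sup>2" for i
  proof -
    define w w' where "w = 1 / h\<^sup>2 + \<beta> i x / (2 * h)" and "w' = 1 / h\<^sup>2 - \<beta> i x / (2 * h)"
    define p q where "p = f x - f (x + h *\<^sub>R axis i 1)" and "q = f x - f (x - h *\<^sub>R axis i 1)"
    have w: "1 / (2 * h\<^sup>2) \<le> w" "1 / (2 * h\<^sup>2) \<le> w'"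
      unfolding w_def w'_def using weights_lower_bound[OF h(1) h(2)[of i]] by auto
    have e: "f (x + h *\<^sub>R axis i 1) = f x - p" "f (x - h *\<^sub>R axis i 1) = f x - q" by (simp_all add: p_def q_def)
    have "h \<noteq> 0" using h by simp
    \<comment> \<open>The centred difference equals \<open>(q - p) / (2 * h)\<close>, hence the
      interest in \<open>q - p\<close>.\<close>
    have "(q - p)\<^sup>2 \<le> 2 * (p\<^sup>2 + q\<^sup>2)"
      using zero_le_power2[of "p + q"] by (simp add: power2_eq_square algebra_simps)
    then have "(q - p)\<^sup>2 / (4 * h\<^sup>2) \<le> (2 * (p\<^sup>2 + q\<^sup>2)) / (4 * h\<^sup>2)" by (intro divide_right_mono) auto
    moreover have "(cdiff h i f x)\<^sup>2 = (q - p)\<^sup>2 / (4 * h\<^sup>2)"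
      by (simp add: cdiff_def e power_divide)
    moreover have "(2 * (p\<^sup>2 + q\<^sup>2)) / (4 * h\<^sup>2) = 1 / (2 * h\<^sup>2) * p\<^sup>2 + 1 / (2 * h\<^sup>2) * q\<^sup>2"
      by (simp add: add_divide_distrib)
    moreover have "\<dots> \<le> w * p\<^sup>2 + w' * q\<^sup>2" using w by (intro add_mono mult_right_mono) auto
    ultimately have "(cdiff h i f x)\<^sup>2 \<le> w * p\<^sup>2 + w' * q\<^sup>2" by linarith
    moreover have "w * ((f x)\<^sup>2 - (f x - p)\<^sup>2) + w' * ((f x)\<^sup>2 - (f x - q)\<^sup>2)
        = 2 * f x * (w * p + w' * q) - (w * p\<^sup>2 + w' * q\<^sup>2)"
      by (simp add: power2_eq_square algebra_simps)
    ultimately show ?thesis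
      unfolding diffusion_weights[OF \<open>h \<noteq> 0\<close>] w_def[symmetric] w'_def[symmetric] e by simp
  qed
  then have "diffusion \<beta> h (\<lambda>x. (f x)\<^sup>2) x
      \<le> (\<Sum>i\<in>UNIV. 2 * f x * (- sdiff h i f x - \<beta> i x * cdiff h i f x) - (cdiff h i f x)\<^sup>2)"
    unfolding diffusion_def by (intro sum_mono)
  also have "\<dots> = 2 * f x * diffusion \<beta> h f x - (\<Sum>i\<in>UNIV. (cdiff h i f x)\<^sup>2)"
    unfolding diffusion_def sum_distrib_left by (rule sum_subtractf)
  finally show ?thesis .
qed

text \<open>At a maximum the diffusion term is nonnegative, so \<open>\<epsilon>\<close> bounds the
  zero-order term alone there and division by \<open>c0\<close> bounds the function. Both
  \<open>\<psi>\<close> and its negative are treated this way.\<close>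

lemma diffusion_maximum_principle:
  fixes a b :: "real ^ 'n"
  assumes box: "\<And>i. a $ i < b $ i" and h: "h > 0" "\<And>i x. h * \<bar>\<beta> i x\<bar> \<le> 1"
    and c: "c0 > 0" "\<And>x. c0 \<le> c x" and \<psi>: "\<psi> \<in> Cinf a b"
    and \<epsilon>: "\<And>x. \<bar>diffusion \<beta> h \<psi> x + c x * \<psi> x\<bar> \<le> \<epsilon>"
  shows "\<bar>\<psi> x\<bar> \<le> \<epsilon> / c0"
proof -
  have upper: "f y \<le> \<epsilon> / c0"
    if f: "f \<in> Cinf a b" and f_le: "\<And>x. diffusion \<beta> h f x + c x * f x \<le> \<epsilon>" for f y
  proof -
    obtain x where x: "\<And>y. f y \<le> f x" using Cinf_attains_max[OF box f] by blast
    have "0 \<le> \<epsilon>" using \<epsilon>[of 0] by linarith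
    have "c x * f x \<le> \<epsilon>"
      using diffusion_at_max[of h \<beta> x f, OF h x] f_le[of x] by linarith
    moreover have "c0 * f x \<le> c x * f x" if "f x \<ge> 0" using c that by (simp add: mult_right_mono)
    moreover have "c0 * f x \<le> \<epsilon>" if "f x < 0"
      using that c(1) \<open>0 \<le> \<epsilon>\<close> mult_pos_neg[of c0 "f x"] by linarith
    ultimately have "c0 * f x \<le> \<epsilon>" by linarith
    then have "f x \<le> \<epsilon> / c0" using c(1) by (simp add: field_simps)
    then show ?thesis using x[of y] by linarith
  qed
  have 1: "diffusion \<beta> h \<psi> x + c x * \<psi> x \<le> \<epsilon>" for x using \<epsilon>[of x] by linarith
  have 2: "diffusion \<beta> h (\<lambda>x. - \<psi> x) x + c x * - \<psi> x \<le> \<epsilon>" for x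
    using \<epsilon>[of x] diffusion_cmult[of \<beta> h "-1" \<psi> x] by simp
  show ?thesis using upper[OF \<psi> 1, of x] upper[OF Cinf_minus[OF \<psi>] 2, of x] by linarith
qed

subsection \<open>A Bernstein estimate\<close>

text \<open>
  At a maximum of the sum of all \<open>(v m)\<^sup>2\<close> and \<open>K\<close> times the sum of all \<open>(u l)\<^sup>2\<close> the
  diffusion operator is nonnegative. By \<open>diffusion_square\<close> the second sum contributes
  \<open>- K\<close> times the squared differences of the \<open>u l\<close>, which absorb the right-hand side of the equations for the \<open>v m\<close>.
\<close>

lemma bernstein_estimate:
  fixes a b :: "real ^ 'n" and v :: "'m \<Rightarrow> real ^ 'n \<Rightarrow> real" and u :: "'l \<Rightarrow> real ^ 'n \<Rightarrow> real"
    and C K B :: real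
  assumes box: "\<And>i. a $ i < b $ i" and fin: "finite I" "finite J"
    and h: "h > 0" "\<And>i x. h * \<bar>\<beta> i x\<bar> \<le> 1" and c: "c0 > 0" "\<And>x. c0 \<le> c x"
    and vC: "\<And>m. m \<in> I \<Longrightarrow> v m \<in> Cinf a b" and uC: "\<And>l. l \<in> J \<Longrightarrow> u l \<in> Cinf a b"
    and v_eq: "\<And>m x. m \<in> I \<Longrightarrow> \<bar>diffusion \<beta> h (v m) x + c x * v m x\<bar>
        \<le> C * (1 + (\<Sum>l\<in>J. \<Sum>i\<in>UNIV. \<bar>cdiff h i (u l) x\<bar>))"
    and u_le: "\<And>l x. l \<in> J \<Longrightarrow> \<bar>u l x\<bar> \<le> C"
    and u_eq: "\<And>l x. l \<in> J \<Longrightarrow> \<bar>diffusion \<beta> h (u l) x\<bar> \<le> C"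
    and C: "C \<ge> 0"
    and K: "K = card I * (2 * C\<^sup>2 / c0) * (card J * CARD('n))"
    and B: "B = (card I * (2 * C\<^sup>2 / c0) + K * (card J * (2 * C\<^sup>2))) / c0 + K * (card J * C\<^sup>2)"
    and m: "m \<in> I"
  shows "(v m y)\<^sup>2 \<le> B"
proof -
  define V where "V x = (\<Sum>m\<in>I. (v m x)\<^sup>2) + K * (\<Sum>l\<in>J. (u l x)\<^sup>2)" for x
  have "V \<in> Cinf a b"
    unfolding V_def[abs_def] using vC uC
    by (intro Cinf_add Cinf_sum Cinf_mult Cinf_const Cinf_power2)
  then obtain x where x: "\<And>y. V y \<le> V x" using Cinf_attains_max[OF box] by blast
  have K0: "K \<ge> 0" using c(1) by (simp add: K)
  define S where "S = (\<Sum>l\<in>J. \<Sum>i\<in>UNIV. \<bar>cdiff h i (u l) x\<bar>)"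
  define Q where "Q = (\<Sum>l\<in>J. \<Sum>i\<in>UNIV. (cdiff h i (u l) x)\<^sup>2)"
  have S0: "S \<ge> 0" unfolding S_def by (intro sum_nonneg) auto
  \<comment> \<open>Cauchy-Schwarz over all pairs of an auxiliary function and a direction; the
    number of pairs reappears as a factor of \<open>K\<close>.\<close>
  have SQ: "S\<^sup>2 \<le> (card J * CARD('n)) * Q"
  proof -
    have "S = (\<Sum>(l, i)\<in>J \<times> UNIV. \<bar>cdiff h i (u l) x\<bar>)"
      "Q = (\<Sum>(l, i)\<in>J \<times> UNIV. \<bar>cdiff h i (u l) x\<bar>\<^sup>2)"
      by (simp_all add: S_def Q_def sum.cartesian_product)
    moreover have "(\<Sum>p\<in>J \<times> UNIV. \<bar>cdiff h (snd p) (u (fst p)) x\<bar>)\<^sup>2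
        \<le> (\<Sum>p\<in>J \<times> UNIV. \<bar>cdiff h (snd p) (u (fst p)) x\<bar>\<^sup>2) * card (J \<times> (UNIV :: 'n set))"
      by (rule sum_squared_le_sum_of_squares)
    ultimately show ?thesis by (simp add: case_prod_unfold card_cartesian_product ac_simps)
  qed
  have v_sq: "diffusion \<beta> h (\<lambda>x. (v m x)\<^sup>2) x \<le> - c0 * (v m x)\<^sup>2 + 2 * C\<^sup>2 / c0 * (1 + S\<^sup>2)"
    if m: "m \<in> I" for m
  proof -
    define r where "r = diffusion \<beta> h (v m) x + c x * v m x"
    have r: "\<bar>r\<bar> \<le> C * (1 + S)" unfolding r_def S_def using v_eq[OF m] .
    have "diffusion \<beta> h (\<lambda>x. (v m x)\<^sup>2) x \<le> 2 * v m x * diffusion \<beta> h (v m) x"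
      using diffusion_square[of h \<beta> x "v m", OF h] sum_nonneg[of UNIV "\<lambda>i. (cdiff h i (v m) x)\<^sup>2"] by simp
    also have "\<dots> = 2 * (v m x * r) - 2 * (c x * (v m x)\<^sup>2)"
      by (simp add: r_def algebra_simps power2_eq_square)
    also have "\<dots> \<le> (c0 * (v m x)\<^sup>2 + r\<^sup>2 / c0) - 2 * (c0 * (v m x)\<^sup>2)"
    proof -
      \<comment> \<open>Completing the square with weight \<open>c0\<close> spends half of the
        damping \<open>2 * c0 * (v m x)\<^sup>2\<close> on the mixed term and keeps the other
        half.\<close>
      have "0 \<le> (c0 * v m x - r)\<^sup>2 / c0" using c(1) by simp
      also have "(c0 * v m x - r)\<^sup>2 / c0 = c0 * (v m x)\<^sup>2 + r\<^sup>2 / c0 - 2 * (v m x * r)"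
        using c(1) by (simp add: field_simps power2_eq_square)
      finally have "2 * (v m x * r) \<le> c0 * (v m x)\<^sup>2 + r\<^sup>2 / c0" by simp
      moreover have "c0 * (v m x)\<^sup>2 \<le> c x * (v m x)\<^sup>2" using c by (intro mult_right_mono) auto
      ultimately show ?thesis by linarith
    qed
    also have "\<dots> = - c0 * (v m x)\<^sup>2 + r\<^sup>2 / c0" by simp
    also have "r\<^sup>2 / c0 \<le> 2 * C\<^sup>2 / c0 * (1 + S\<^sup>2)"
    proof -
      have "r\<^sup>2 \<le> (C * (1 + S))\<^sup>2" using r abs_le_square_iff[of r "C * (1 + S)"] C S0 by simp
      also have "\<dots> \<le> C\<^sup>2 * (2 * (1 + S\<^sup>2))"
        unfolding power_mult_distrib using zero_le_power2[of "1 - S"]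
        by (intro mult_left_mono) (auto simp: power2_eq_square algebra_simps)
      finally have "r\<^sup>2 / c0 \<le> C\<^sup>2 * (2 * (1 + S\<^sup>2)) / c0" using c(1) by (intro divide_right_mono) auto
      then show ?thesis by (simp add: algebra_simps)
    qed
    finally show ?thesis by simp
  qed
  have u_sq: "diffusion \<beta> h (\<lambda>x. (u l x)\<^sup>2) x \<le> 2 * C\<^sup>2 - (\<Sum>i\<in>UNIV. (cdiff h i (u l) x)\<^sup>2)"
    if l: "l \<in> J" for l
  proof -
    have "u l x * diffusion \<beta> h (u l) x \<le> \<bar>u l x\<bar> * \<bar>diffusion \<beta> h (u l) x\<bar>"
      by (metis abs_ge_self abs_mult)
    also have "\<dots> \<le> C * C" using u_le[OF l] u_eq[OF l] C by (intro mult_mono) auto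
    finally show ?thesis
      using diffusion_square[of h \<beta> x "u l", OF h] by (simp add: power2_eq_square algebra_simps)
  qed
  have "0 \<le> diffusion \<beta> h V x" using diffusion_at_max[of h \<beta> x V, OF h x] .
  also have "diffusion \<beta> h V x
      = (\<Sum>m\<in>I. diffusion \<beta> h (\<lambda>x. (v m x)\<^sup>2) x) + K * (\<Sum>l\<in>J. diffusion \<beta> h (\<lambda>x. (u l x)\<^sup>2) x)"
    unfolding V_def[abs_def] by (simp add: diffusion_add diffusion_cmult diffusion_sum)
  also have "\<dots> \<le> (\<Sum>m\<in>I. - c0 * (v m x)\<^sup>2 + 2 * C\<^sup>2 / c0 * (1 + S\<^sup>2))
      + K * (\<Sum>l\<in>J. 2 * C\<^sup>2 - (\<Sum>i\<in>UNIV. (cdiff h i (u l) x)\<^sup>2))"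
    using v_sq u_sq K0 by (intro add_mono mult_left_mono sum_mono) auto
  also have "\<dots> = - c0 * (\<Sum>m\<in>I. (v m x)\<^sup>2) + card I * (2 * C\<^sup>2 / c0) + card I * (2 * C\<^sup>2 / c0) * S\<^sup>2
      + K * (card J * (2 * C\<^sup>2)) - K * Q"
    unfolding Q_def by (simp add: sum.distrib sum_subtractf sum_negf sum_distrib_left algebra_simps add_divide_distrib)
  \<comment> \<open>This is where \<open>K\<close> comes from: it is the coefficient of
    \<open>S\<^sup>2\<close> times the number of pairs, so that \<open>- K * Q\<close> cancels the
    growth in the differences.\<close>
  also have "card I * (2 * C\<^sup>2 / c0) * S\<^sup>2 \<le> K * Q"
    unfolding K using mult_left_mono[OF SQ, of "card I * (2 * C\<^sup>2 / c0)"] c(1) by (simp add: mult.assoc)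
  finally have "c0 * (\<Sum>m\<in>I. (v m x)\<^sup>2) \<le> card I * (2 * C\<^sup>2 / c0) + K * (card J * (2 * C\<^sup>2))" by simp
  then have "(\<Sum>m\<in>I. (v m x)\<^sup>2) \<le> (card I * (2 * C\<^sup>2 / c0) + K * (card J * (2 * C\<^sup>2))) / c0"
    using c(1) by (simp add: pos_le_divide_eq mult.commute)
  moreover have "K * (\<Sum>l\<in>J. (u l x)\<^sup>2) \<le> K * (card J * C\<^sup>2)"
  proof (intro mult_left_mono K0)
    have "(u l x)\<^sup>2 \<le> C\<^sup>2" if "l \<in> J" for l
      using u_le[OF that, of x] abs_le_square_iff[of "u l x" C] C by simp
    then show "(\<Sum>l\<in>J. (u l x)\<^sup>2) \<le> card J * C\<^sup>2"
      using sum_bounded_above[of J "\<lambda>l. (u l x)\<^sup>2" "C\<^sup>2"] by simp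
  qed
  \<comment> \<open>The estimate at the maximum point of \<open>V\<close> passes to every
    \<open>y\<close>; the two summands of \<open>B\<close> bound the two parts of \<open>V\<close>
    at that point.\<close>
  ultimately have "V y \<le> B" using x[of y] unfolding V_def[of x] B by linarith
  moreover have "(v m y)\<^sup>2 \<le> (\<Sum>m\<in>I. (v m y)\<^sup>2)" using fin m by (intro member_le_sum) auto
  moreover have "0 \<le> K * (\<Sum>l\<in>J. (u l y)\<^sup>2)" using K0 by (intro mult_nonneg_nonneg sum_nonneg) auto
  ultimately show ?thesis unfolding V_def by linarith
qed

section \<open>Derivative bounds uniform in the step size\<close>

text \<open>Second differences commute with \<open>pderivs is\<close>, so only the drift leaves a
  commutator. The Leibniz bound is applied with \<open>cdiff h i \<phi>\<close> as the
  differentiated factor, which keeps \<open>h\<close> out of the constant.\<close>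

lemma pderivs_diffusion:
  fixes a b :: "real ^ 'n"
  assumes box: "\<And>i. a $ i < b $ i" and \<beta>: "\<And>i. \<beta> i \<in> Cinf a b"
  shows "\<exists>C\<ge>0. \<forall>h. \<forall>\<phi>\<in>Cinf a b. \<forall>x.
    \<bar>pderivs is (diffusion \<beta> h \<phi>) x - diffusion \<beta> h (pderivs is \<phi>) x\<bar>
      \<le> C * (\<Sum>ls\<in>lists_below (length is). \<Sum>i\<in>UNIV. \<bar>cdiff h i (pderivs ls \<phi>) x\<bar>)"
proof -
  have "\<forall>i. \<exists>C\<ge>0. \<forall>\<psi> x. smooth \<psi> \<longrightarrow>
      \<bar>pderivs is (\<lambda>x. \<beta> i x * \<psi> x) x - \<beta> i x * pderivs is \<psi> x\<bar>
        \<le> C * (\<Sum>ls\<in>lists_below (length is). \<bar>pderivs ls \<psi> x\<bar>)"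
    using pderivs_mult_bound[OF box \<beta>] by simp
  from choice[OF this] obtain C where C: "\<forall>i. 0 \<le> C i \<and> (\<forall>\<psi> x. smooth \<psi> \<longrightarrow>
      \<bar>pderivs is (\<lambda>x. \<beta> i x * \<psi> x) x - \<beta> i x * pderivs is \<psi> x\<bar>
        \<le> C i * (\<Sum>ls\<in>lists_below (length is). \<bar>pderivs ls \<psi> x\<bar>))" ..
  define C' where "C' = (\<Sum>i\<in>UNIV. C i)"
  have C': "C i \<le> C'" for i unfolding C'_def using C by (intro member_le_sum) auto
  have "C' \<ge> 0" unfolding C'_def using C by (intro sum_nonneg) auto
  have "\<bar>pderivs is (diffusion \<beta> h \<phi>) x - diffusion \<beta> h (pderivs is \<phi>) x\<bar>
      \<le> C' * (\<Sum>ls\<in>lists_below (length is). \<Sum>i\<in>UNIV. \<bar>cdiff h i (pderivs ls \<phi>) x\<bar>)"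
    if \<phi>: "\<phi> \<in> Cinf a b" for h \<phi> x
  proof -
    let ?E = "\<lambda>i x. pderivs is (\<lambda>x. \<beta> i x * cdiff h i \<phi> x) x - \<beta> i x * cdiff h i (pderivs is \<phi>) x"
    have C1: "(\<lambda>x. - 1 * sdiff h i \<phi> x) \<in> Cinf a b" for i by (intro Cinf_mult Cinf_const Cinf_sdiff \<phi>)
    have C2: "(\<lambda>x. \<beta> i x * cdiff h i \<phi> x) \<in> Cinf a b" for i by (intro Cinf_mult \<beta> Cinf_cdiff \<phi>)
    have C3: "(\<lambda>x. - 1 * (\<beta> i x * cdiff h i \<phi> x)) \<in> Cinf a b" for i by (intro Cinf_mult Cinf_const C2)
    have "diffusion \<beta> h \<phi> = (\<lambda>x. \<Sum>i\<in>UNIV. - 1 * sdiff h i \<phi> x + - 1 * (\<beta> i x * cdiff h i \<phi> x))"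
      by (auto simp: diffusion_def)
    then have "pderivs is (diffusion \<beta> h \<phi>) x
        = (\<Sum>i\<in>UNIV. - 1 * sdiff h i (pderivs is \<phi>) x + - 1 * pderivs is (\<lambda>x. \<beta> i x * cdiff h i \<phi> x) x)"
      by (simp only: pderivs_sum[OF Cinf_add[OF C1 C3]] pderivs_add[OF Cinf_smooth[OF C1] Cinf_smooth[OF C3]]
          pderivs_cmult[OF Cinf_smooth[OF Cinf_sdiff[OF \<phi>]]] pderivs_cmult[OF Cinf_smooth[OF C2]] pderivs_sdiff[OF \<phi>])
    then have "pderivs is (diffusion \<beta> h \<phi>) x - diffusion \<beta> h (pderivs is \<phi>) x = - (\<Sum>i\<in>UNIV. ?E i x)"
      unfolding diffusion_def by (simp add: sum_subtractf sum_negf)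
    then have "\<bar>pderivs is (diffusion \<beta> h \<phi>) x - diffusion \<beta> h (pderivs is \<phi>) x\<bar> \<le> (\<Sum>i\<in>UNIV. \<bar>?E i x\<bar>)"
      using sum_abs by simp
    also have "\<dots> \<le> (\<Sum>i\<in>UNIV. C' * (\<Sum>ls\<in>lists_below (length is). \<bar>cdiff h i (pderivs ls \<phi>) x\<bar>))"
    proof (intro sum_mono)
      fix i
      have "\<bar>?E i x\<bar> \<le> C i * (\<Sum>ls\<in>lists_below (length is). \<bar>cdiff h i (pderivs ls \<phi>) x\<bar>)"
        using C Cinf_smooth[OF Cinf_cdiff[OF \<phi>]] by (simp flip: pderivs_cdiff[OF \<phi>])
      also have "\<dots> \<le> C' * (\<Sum>ls\<in>lists_below (length is). \<bar>cdiff h i (pderivs ls \<phi>) x\<bar>)"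
        by (intro mult_right_mono C' sum_nonneg) auto
      finally show "\<bar>?E i x\<bar> \<le> \<dots>" .
    qed
    also have "\<dots> = C' * (\<Sum>ls\<in>lists_below (length is). \<Sum>i\<in>UNIV. \<bar>cdiff h i (pderivs ls \<phi>) x\<bar>)"
      by (subst sum.swap) (simp add: sum_distrib_left)
    finally show ?thesis .
  qed
  then show ?thesis using \<open>C' \<ge> 0\<close> by blast
qed

text \<open>Differentiating the equation leaves the derivative of the source and two commutators,
  with the zero-order coefficient and with the drift. The constant is fixed before \<open>h\<close>
  and the solution.\<close>

lemma pderivs_solution:
  fixes a b :: "real ^ 'n"
  assumes box: "\<And>i. a $ i < b $ i" and \<beta>: "\<And>i. \<beta> i \<in> Cinf a b" and c: "c \<in> Cinf a b" and g: "g \<in> Cinf a b"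
  shows "\<exists>C\<ge>0. \<forall>h. \<forall>\<phi>\<in>Cinf a b. (\<forall>x. diffusion \<beta> h \<phi> x + c x * \<phi> x = g x) \<longrightarrow>
    (\<forall>x. \<bar>diffusion \<beta> h (pderivs is \<phi>) x + c x * pderivs is \<phi> x\<bar>
      \<le> C * (1 + (\<Sum>ls\<in>lists_below (length is). \<bar>pderivs ls \<phi> x\<bar>)
        + (\<Sum>ls\<in>lists_below (length is). \<Sum>i\<in>UNIV. \<bar>cdiff h i (pderivs ls \<phi>) x\<bar>)))"
proof -
  obtain C1 where C1: "C1 \<ge> 0" "\<forall>h. \<forall>\<phi>\<in>Cinf a b. \<forall>x.
    \<bar>pderivs is (diffusion \<beta> h \<phi>) x - diffusion \<beta> h (pderivs is \<phi>) x\<bar>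
      \<le> C1 * (\<Sum>ls\<in>lists_below (length is). \<Sum>i\<in>UNIV. \<bar>cdiff h i (pderivs ls \<phi>) x\<bar>)"
    using pderivs_diffusion[where \<beta>=\<beta>, OF box \<beta>] by blast
  obtain C2 where C2: "C2 \<ge> 0" "\<forall>\<psi> x. smooth \<psi> \<longrightarrow>
    \<bar>pderivs is (\<lambda>x. c x * \<psi> x) x - c x * pderivs is \<psi> x\<bar>
      \<le> C2 * (\<Sum>ls\<in>lists_below (length is). \<bar>pderivs ls \<psi> x\<bar>)"
    using pderivs_mult_bound[OF box c] by blast
  obtain G where G: "G \<ge> 0" "\<And>x. \<bar>pderivs is g x\<bar> \<le> G" using Cinf_bounded[OF box Cinf_pderivs[OF g]] by blast
  define C where "C = G + C1 + C2"
  have "\<bar>diffusion \<beta> h (pderivs is \<phi>) x + c x * pderivs is \<phi> x\<bar>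
      \<le> C * (1 + (\<Sum>ls\<in>lists_below (length is). \<bar>pderivs ls \<phi> x\<bar>)
        + (\<Sum>ls\<in>lists_below (length is). \<Sum>i\<in>UNIV. \<bar>cdiff h i (pderivs ls \<phi>) x\<bar>))"
    if \<phi>: "\<phi> \<in> Cinf a b" and eq: "\<And>x. diffusion \<beta> h \<phi> x + c x * \<phi> x = g x" for h \<phi> x
  proof -
    define P where "P = (\<Sum>ls\<in>lists_below (length is). \<bar>pderivs ls \<phi> x\<bar>)"
    define D where "D = (\<Sum>ls\<in>lists_below (length is). \<Sum>i\<in>UNIV. \<bar>cdiff h i (pderivs ls \<phi>) x\<bar>)"
    have PD: "P \<ge> 0" "D \<ge> 0" unfolding P_def D_def by (intro sum_nonneg; simp)+
    have "diffusion \<beta> h \<phi> \<in> Cinf a b"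
      unfolding diffusion_def[abs_def]
      by (intro Cinf_sum Cinf_diff Cinf_minus Cinf_mult \<beta> Cinf_sdiff Cinf_cdiff \<phi>)
    then have "pderivs is (\<lambda>x. diffusion \<beta> h \<phi> x + c x * \<phi> x)
        = (\<lambda>x. pderivs is (diffusion \<beta> h \<phi>) x + pderivs is (\<lambda>x. c x * \<phi> x) x)"
      using \<phi> c by (intro pderivs_add Cinf_smooth[of _ a b] Cinf_mult)
    then have "pderivs is g x = pderivs is (diffusion \<beta> h \<phi>) x + pderivs is (\<lambda>x. c x * \<phi> x) x"
      using eq by simp
    moreover have "\<bar>pderivs is (diffusion \<beta> h \<phi>) x - diffusion \<beta> h (pderivs is \<phi>) x\<bar> \<le> C1 * D"
      unfolding D_def using C1(2) \<phi> by blast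
    moreover have "\<bar>pderivs is (\<lambda>x. c x * \<phi> x) x - c x * pderivs is \<phi> x\<bar> \<le> C2 * P"
      unfolding P_def using C2(2) Cinf_smooth[OF \<phi>] by blast
    ultimately have "\<bar>diffusion \<beta> h (pderivs is \<phi>) x + c x * pderivs is \<phi> x\<bar> \<le> G * 1 + C2 * P + C1 * D"
      using G(2)[of x] by linarith
    also have "\<dots> \<le> C * 1 + C * P + C * D"
      unfolding C_def using PD G C1(1) C2(1) by (intro add_mono mult_right_mono) auto
    finally show ?thesis unfolding P_def D_def by (simp add: distrib_left)
  qed
  moreover have "C \<ge> 0" unfolding C_def using G C1(1) C2(1) by simp
  ultimately show ?thesis by blast
qed

text \<open>Controls first differences of those derivatives whose next order is already
  bounded.\<close>

lemma cdiff_bound: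
  fixes f :: "real ^ 'n \<Rightarrow> real"
  assumes "smooth f" "h > 0" "\<And>x. \<bar>partial_deriv i f x\<bar> \<le> B"
  shows "\<bar>cdiff h i f x\<bar> \<le> B"
proof -
  have eq: "(x - h *\<^sub>R axis i 1) + (2 * h) *\<^sub>R axis i 1 = x + h *\<^sub>R axis i 1"
    using scaleR_left_distrib[of h h "axis i 1 :: real ^ 'n"] by (simp only: mult_2) simp
  have "\<bar>f ((x - h *\<^sub>R axis i 1) + (2 * h) *\<^sub>R axis i 1) - f (x - h *\<^sub>R axis i 1)\<bar> \<le> 2 * h * B"
    using partial_deriv_increment[OF assms(1) _ assms(3), of "2 * h" "x - h *\<^sub>R axis i 1"] assms(2)
    by simp
  then have "\<bar>f (x + h *\<^sub>R axis i 1) - f (x - h *\<^sub>R axis i 1)\<bar> \<le> 2 * h * B" unfolding eq .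
  then show ?thesis using assms(2) by (simp add: cdiff_def field_simps)
qed

text \<open>Induction on the order \<open>s\<close>. For a word of length \<open>s\<close> the
  uncontrolled terms are first differences of words of length \<open>s - 1\<close>; the Bernstein
  estimate absorbs them, with all shorter words as auxiliary functions. For a shorter word the
  commutators involve differences of words of length at most \<open>s - 2\<close>, hence derivatives
  of order at most \<open>s - 1\<close>, bounded by induction. At \<open>s = 0\<close> there are no
  auxiliary functions and the damping alone gives the bound.\<close>

lemma solution_pderivs_bound:
  fixes a b :: "real ^ 'n"
  assumes box: "\<And>i. a $ i < b $ i" and \<beta>: "\<And>i. \<beta> i \<in> Cinf a b"
    and c: "c \<in> Cinf a b" "c0 > 0" "\<And>x. c0 \<le> c x" and g: "g \<in> Cinf a b"
  shows "\<exists>M. \<forall>h. \<forall>\<phi>\<in>Cinf a b. h > 0 \<longrightarrow> (\<forall>i x. h * \<bar>\<beta> i x\<bar> \<le> 1) \<longrightarrow>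
    (\<forall>x. diffusion \<beta> h \<phi> x + c x * \<phi> x = g x) \<longrightarrow> (\<forall>x. \<bar>pderivs is \<phi> x\<bar> \<le> M)"
proof (induction "is" rule: measure_induct_rule[of length])
  case (less "is")
  define s where "s = length is"
  define sol where "sol h \<phi> \<longleftrightarrow> \<phi> \<in> Cinf a b \<and> h > 0 \<and> (\<forall>i x. h * \<bar>\<beta> i x\<bar> \<le> 1) \<and>
      (\<forall>x. diffusion \<beta> h \<phi> x + c x * \<phi> x = g x)" for h \<phi>
  have "\<forall>ls\<in>lists_below s. \<exists>M. \<forall>h \<phi> x. sol h \<phi> \<longrightarrow> \<bar>pderivs ls \<phi> x\<bar> \<le> M"
  proof
    fix ls :: "'n list" assume "ls \<in> lists_below s"
    then obtain M where "\<forall>h. \<forall>\<phi>\<in>Cinf a b. h > 0 \<longrightarrow> (\<forall>i x. h * \<bar>\<beta> i x\<bar> \<le> 1) \<longrightarrow>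
        (\<forall>x. diffusion \<beta> h \<phi> x + c x * \<phi> x = g x) \<longrightarrow> (\<forall>x. \<bar>pderivs ls \<phi> x\<bar> \<le> M)"
      using less[of ls] by (auto simp: lists_below_def s_def)
    then show "\<exists>M. \<forall>h \<phi> x. sol h \<phi> \<longrightarrow> \<bar>pderivs ls \<phi> x\<bar> \<le> M"
      unfolding sol_def by blast
  qed
  from bchoice[OF this] obtain M where
    M: "\<forall>ls\<in>lists_below s. \<forall>h \<phi> x. sol h \<phi> \<longrightarrow> \<bar>pderivs ls \<phi> x\<bar> \<le> M ls" ..
  define N where "N = (\<Sum>ls\<in>lists_below s. \<bar>M ls\<bar>)"
  have N0: "N \<ge> 0" unfolding N_def by (simp add: sum_nonneg)
  have N: "\<bar>pderivs ls \<phi> x\<bar> \<le> N" if "sol h \<phi>" "length ls < s" for ls h \<phi> x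
  proof -
    have ls: "ls \<in> lists_below s" using that by (simp add: lists_below_def)
    then have "\<bar>pderivs ls \<phi> x\<bar> \<le> \<bar>M ls\<bar>" using M that(1) abs_ge_self order_trans by blast
    also have "\<dots> \<le> N" unfolding N_def using ls member_le_sum[of ls "lists_below s" "\<lambda>ls. \<bar>M ls\<bar>"] by simp
    finally show ?thesis .
  qed
  have "\<forall>ls. \<exists>C\<ge>0. \<forall>h. \<forall>\<phi>\<in>Cinf a b. (\<forall>x. diffusion \<beta> h \<phi> x + c x * \<phi> x = g x) \<longrightarrow>
    (\<forall>x. \<bar>diffusion \<beta> h (pderivs ls \<phi>) x + c x * pderivs ls \<phi> x\<bar>
      \<le> C * (1 + (\<Sum>ms\<in>lists_below (length ls). \<bar>pderivs ms \<phi> x\<bar>)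
        + (\<Sum>ms\<in>lists_below (length ls). \<Sum>i\<in>UNIV. \<bar>cdiff h i (pderivs ms \<phi>) x\<bar>)))"
    using pderivs_solution[where \<beta>=\<beta>, OF box \<beta> c(1) g] by blast
  from choice[OF this] obtain C where C: "\<forall>ls. 0 \<le> C ls \<and> (\<forall>h. \<forall>\<phi>\<in>Cinf a b.
    (\<forall>x. diffusion \<beta> h \<phi> x + c x * \<phi> x = g x) \<longrightarrow>
    (\<forall>x. \<bar>diffusion \<beta> h (pderivs ls \<phi>) x + c x * pderivs ls \<phi> x\<bar>
      \<le> C ls * (1 + (\<Sum>ms\<in>lists_below (length ls). \<bar>pderivs ms \<phi> x\<bar>)
        + (\<Sum>ms\<in>lists_below (length ls). \<Sum>i\<in>UNIV. \<bar>cdiff h i (pderivs ms \<phi>) x\<bar>))))" ..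
  define I where "I = {ls :: 'n list. length ls = s}"
  have "I \<subseteq> lists_below (Suc s)" by (auto simp: I_def lists_below_def)
  then have finI: "finite I" using finite_subset finite_lists_below by blast
  define C0 where "C0 = (\<Sum>ls\<in>lists_below (Suc s). C ls)"
  have C0_nonneg: "C0 \<ge> 0" unfolding C0_def using C by (simp add: sum_nonneg)
  obtain c1 where c1: "c1 \<ge> 0" "\<And>x. \<bar>c x\<bar> \<le> c1" using Cinf_bounded[OF box c(1)] by blast
  \<comment> \<open>Bounds both sums in the differentiated equation of any word shorter than
    \<open>s\<close>: each word in the sum costs \<open>N\<close> for its value and \<open>N\<close>
    for each of its \<open>CARD('n)\<close> differences.\<close>
  define T where "T = card (lists_below s :: 'n list set) * (N + CARD('n) * N)"
  have T0: "T \<ge> 0" unfolding T_def using N0 by simp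
  \<comment> \<open>One constant for three roles in \<open>bernstein_estimate\<close>:
    \<open>C0 * (1 + T)\<close> for the equations of order \<open>s\<close>, \<open>N\<close> for
    the size of shorter words, and \<open>c1 * N\<close> for moving the zero-order term out of their
    equations.\<close>
  define E where "E = C0 * (1 + T) + c1 * N + N"
  have E0: "E \<ge> 0" unfolding E_def using C0_nonneg T0 c1(1) N0 by simp
  have eq: "\<bar>diffusion \<beta> h (pderivs ls \<phi>) x + c x * pderivs ls \<phi> x\<bar>
      \<le> C0 * (1 + (\<Sum>ms\<in>lists_below (length ls). \<bar>pderivs ms \<phi> x\<bar>)
        + (\<Sum>ms\<in>lists_below (length ls). \<Sum>i\<in>UNIV. \<bar>cdiff h i (pderivs ms \<phi>) x\<bar>))"
    if "sol h \<phi>" "length ls \<le> s" for h \<phi> ls x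
  proof -
    have "ls \<in> lists_below (Suc s)" using that by (simp add: lists_below_def)
    then have "C ls \<le> C0" unfolding C0_def using C member_le_sum[of ls "lists_below (Suc s)" C] by simp
    moreover have "\<bar>diffusion \<beta> h (pderivs ls \<phi>) x + c x * pderivs ls \<phi> x\<bar>
      \<le> C ls * (1 + (\<Sum>ms\<in>lists_below (length ls). \<bar>pderivs ms \<phi> x\<bar>)
        + (\<Sum>ms\<in>lists_below (length ls). \<Sum>i\<in>UNIV. \<bar>cdiff h i (pderivs ms \<phi>) x\<bar>))"
      using C that(1) unfolding sol_def by blast
    moreover have "0 \<le> 1 + (\<Sum>ms\<in>lists_below (length ls). \<bar>pderivs ms \<phi> x\<bar>)
        + (\<Sum>ms\<in>lists_below (length ls). \<Sum>i\<in>UNIV. \<bar>cdiff h i (pderivs ms \<phi>) x\<bar>)"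
      by (intro add_nonneg_nonneg sum_nonneg) auto
    ultimately show ?thesis using mult_right_mono order_trans by blast
  qed
  define K where "K = card I * (2 * E\<^sup>2 / c0) * (card (lists_below s :: 'n list set) * CARD('n))"
  define B where "B = (card I * (2 * E\<^sup>2 / c0) + K * (card (lists_below s :: 'n list set) * (2 * E\<^sup>2))) / c0
      + K * (card (lists_below s :: 'n list set) * E\<^sup>2)"
  have "\<bar>pderivs is \<phi> x\<bar> \<le> sqrt B" if sol: "sol h \<phi>" for h \<phi> x
  proof -
    have \<phi>: "\<phi> \<in> Cinf a b" and h: "h > 0" "\<And>i x. h * \<bar>\<beta> i x\<bar> \<le> 1" using sol by (auto simp: sol_def)
    have "(pderivs is \<phi> x)\<^sup>2 \<le> B"
    proof (rule bernstein_estimate[where I=I and J="lists_below s" and v="\<lambda>ls. pderivs ls \<phi>"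
          and u="\<lambda>ls. pderivs ls \<phi>" and c=c, OF box finI finite_lists_below h c(2,3) _ _ _ _ _ E0 K_def B_def])
      show "pderivs ls \<phi> \<in> Cinf a b" for ls using Cinf_pderivs[OF \<phi>] .
      show "pderivs ls \<phi> \<in> Cinf a b" for ls using Cinf_pderivs[OF \<phi>] .
      show "is \<in> I" by (simp add: I_def s_def)
      have EC: "C0 * (1 + T) \<le> E" unfolding E_def using c1(1) N0 by simp
      {
        fix ls x assume "ls \<in> I"
        then have ls: "length ls = s" by (simp add: I_def)
        define D where "D = (\<Sum>ms\<in>lists_below s. \<Sum>i\<in>UNIV. \<bar>cdiff h i (pderivs ms \<phi>) x\<bar>)"
        have D0: "D \<ge> 0" unfolding D_def by (intro sum_nonneg) auto
        have "(\<Sum>ms\<in>lists_below s. \<bar>pderivs ms \<phi> x\<bar>) \<le> card (lists_below s :: 'n list set) * N"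
          by (rule sum_bounded_above) (use N[OF sol] in \<open>simp add: lists_below_def\<close>)
        also have "\<dots> \<le> T" unfolding T_def using N0 by (intro mult_left_mono) auto
        finally have "1 + (\<Sum>ms\<in>lists_below s. \<bar>pderivs ms \<phi> x\<bar>) + D \<le> 1 + T + D" by simp
        \<comment> \<open>Pulls the known part out as a factor, leaving the shape
          \<open>1 + D\<close> that the Bernstein estimate expects.\<close>
        also have "\<dots> \<le> (1 + T) * (1 + D)" using T0 D0 by (simp add: algebra_simps)
        finally have "C0 * (1 + (\<Sum>ms\<in>lists_below s. \<bar>pderivs ms \<phi> x\<bar>) + D) \<le> C0 * ((1 + T) * (1 + D))"
          using C0_nonneg by (intro mult_left_mono) auto
        also have "\<dots> \<le> E * (1 + D)"
          using mult_right_mono[OF EC, of "1 + D"] D0 by (simp add: mult.assoc)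
        finally show "\<bar>diffusion \<beta> h (pderivs ls \<phi>) x + c x * pderivs ls \<phi> x\<bar>
            \<le> E * (1 + (\<Sum>ms\<in>lists_below s. \<Sum>i\<in>UNIV. \<bar>cdiff h i (pderivs ms \<phi>) x\<bar>))"
          using eq[OF sol, of ls x] unfolding ls D_def by linarith
      }
      {
        fix ls :: "'n list" and x assume "ls \<in> lists_below s"
        then have ls: "length ls < s" by (simp add: lists_below_def)
        have le: "\<bar>pderivs ls \<phi> x\<bar> \<le> N" for x using N[OF sol ls] .
        show "\<bar>pderivs ls \<phi> x\<bar> \<le> E" using le[of x] N0 C0_nonneg T0 c1(1) unfolding E_def
          by (smt (verit) mult_nonneg_nonneg)
        have "(\<Sum>ms\<in>lists_below (length ls). \<bar>pderivs ms \<phi> x\<bar>)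
            + (\<Sum>ms\<in>lists_below (length ls). \<Sum>i\<in>UNIV. \<bar>cdiff h i (pderivs ms \<phi>) x\<bar>)
          = (\<Sum>ms\<in>lists_below (length ls). \<bar>pderivs ms \<phi> x\<bar> + (\<Sum>i\<in>UNIV. \<bar>cdiff h i (pderivs ms \<phi>) x\<bar>))"
          by (simp add: sum.distrib)
        also have "\<dots> \<le> card (lists_below (length ls) :: 'n list set) * (N + CARD('n) * N)"
        proof (rule sum_bounded_above)
          fix ms :: "'n list" assume "ms \<in> lists_below (length ls)"
          then have ms: "length ms < length ls" by (simp add: lists_below_def)
          \<comment> \<open>The word \<open>i # ms\<close> is at most as long as \<open>ls\<close>,
            hence still shorter than \<open>s\<close>.\<close>
          have "\<bar>cdiff h i (pderivs ms \<phi>) x\<bar> \<le> N" for i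
            using cdiff_bound[OF smooth_pderivs[OF Cinf_smooth[OF \<phi>]] h(1), of i ms N] N[OF sol, of "i # ms"] ms ls
            by simp
          then have "(\<Sum>i\<in>UNIV. \<bar>cdiff h i (pderivs ms \<phi>) x\<bar>) \<le> CARD('n) * N"
            using sum_bounded_above[of UNIV "\<lambda>i. \<bar>cdiff h i (pderivs ms \<phi>) x\<bar>" N] by simp
          then show "\<bar>pderivs ms \<phi> x\<bar> + (\<Sum>i\<in>UNIV. \<bar>cdiff h i (pderivs ms \<phi>) x\<bar>) \<le> N + CARD('n) * N"
            using N[OF sol, of ms x] ms ls by simp
        qed
        also have "\<dots> \<le> T"
          unfolding T_def using N0 ls lists_below_mono[of "length ls" s]
          by (intro mult_right_mono) (auto intro!: card_mono)
        finally have "C0 * (1 + ((\<Sum>ms\<in>lists_below (length ls). \<bar>pderivs ms \<phi> x\<bar>)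
            + (\<Sum>ms\<in>lists_below (length ls). \<Sum>i\<in>UNIV. \<bar>cdiff h i (pderivs ms \<phi>) x\<bar>))) \<le> C0 * (1 + T)"
          using C0_nonneg by (intro mult_left_mono) auto
        then have "\<bar>diffusion \<beta> h (pderivs ls \<phi>) x + c x * pderivs ls \<phi> x\<bar> \<le> C0 * (1 + T)"
          using eq[OF sol, of ls x] ls by (simp add: add.assoc)
        moreover have "\<bar>c x * pderivs ls \<phi> x\<bar> \<le> c1 * N"
          unfolding abs_mult using c1 le by (intro mult_mono) auto
        ultimately show "\<bar>diffusion \<beta> h (pderivs ls \<phi>) x\<bar> \<le> E" unfolding E_def using N0 by linarith
      }
    qed
    then have "sqrt ((pderivs is \<phi> x)\<^sup>2) \<le> sqrt B" by (rule real_sqrt_le_mono)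
    then show ?thesis by simp
  qed
  then show ?case unfolding sol_def by blast
qed

subsection \<open>Solving the elliptic equation\<close>

text \<open>Solve the scheme for the centre value: \<open>(W + c x) * \<phi> x\<close> is
  \<open>g x\<close> plus a weighted sum over the neighbours. The drift parts of opposite neighbours
  cancel, so the weights add up to the constant \<open>W\<close>; after division their total is at
  most \<open>W / (W + c0)\<close>, which is below 1.\<close>

lemma diffusion_solution_exists:
  fixes a b :: "real ^ 'n"
  assumes box: "\<And>i. a $ i < b $ i" and \<beta>: "\<And>i. \<beta> i \<in> Cinf a b"
    and c: "c \<in> Cinf a b" "c0 > 0" "\<And>x. c0 \<le> c x" and g: "g \<in> Cinf a b"
    and h: "h > 0" "\<And>i x. h * \<bar>\<beta> i x\<bar> \<le> 1"
  shows "\<exists>\<phi>\<in>Cinf a b. \<forall>x. diffusion \<beta> h \<phi> x + c x * \<phi> x = g x"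
proof -
  define W where "W = CARD('n) * (2 / h\<^sup>2)"
  have W: "W > 0" using h(1) by (simp add: W_def)
  have Wc: "W + c x > 0" for x using W c(2) c(3)[of x] by linarith
  define J where "J = (UNIV :: 'n set) \<times> {1, - 1 :: real}"
  define w where "w p x = 1 / h\<^sup>2 + snd p * \<beta> (fst p) x / (2 * h)" for p x
  define \<alpha> where "\<alpha> p x = inverse (W + c x) * w p x" for p x
  define v where "v p = (snd p * h) *\<^sub>R axis (fst p) (1::real)" for p :: "'n \<times> real"
  have sumJ: "(\<Sum>p\<in>J. F p) = (\<Sum>i\<in>UNIV. F (i, 1) + F (i, - 1))" for F :: "'n \<times> real \<Rightarrow> real"
    unfolding J_def by (simp add: sum.cartesian_product')
  have sumw: "(\<Sum>p\<in>J. w p x) = W" for x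
    unfolding sumJ by (simp add: w_def W_def)
  have \<alpha>C: "\<alpha> p \<in> Cinf a b" for p
    unfolding \<alpha>_def[abs_def] w_def
    by (intro Cinf_mult Cinf_inverse Cinf_add Cinf_const Cinf_divide_const \<beta> c(1) Wc)
  have \<alpha>0: "\<alpha> p x \<ge> 0" if "p \<in> J" for p x
    using that Wc[of x] weights_nonneg[OF h(1) h(2), of "fst p" x]
    by (auto simp: \<alpha>_def w_def J_def)
  have \<theta>: "(\<Sum>p\<in>J. \<alpha> p x) \<le> W / (W + c0)" for x
    unfolding \<alpha>_def sum_distrib_left[symmetric] sumw
    using W Wc[of x] c(2) c(3)[of x] by (simp add: field_simps)
  have gC: "(\<lambda>x. inverse (W + c x) * g x) \<in> Cinf a b"
    by (intro Cinf_mult Cinf_inverse Cinf_add Cinf_const c(1) Wc g)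
  obtain \<phi> where \<phi>: "\<phi> \<in> Cinf a b"
    "\<And>x. \<phi> x = inverse (W + c x) * g x + (\<Sum>p\<in>J. \<alpha> p x * \<phi> (x + v p))"
    using shift_fixed_point[OF box _ \<alpha>C \<alpha>0 \<theta> _ _ gC, of v] W c(2) by (auto simp: J_def)
  have "diffusion \<beta> h \<phi> x + c x * \<phi> x = g x" for x
  proof -
    have "h \<noteq> 0" using h(1) by simp
    have "(W + c x) * \<phi> x = (W + c x) * (inverse (W + c x) * (g x + (\<Sum>p\<in>J. w p x * \<phi> (x + v p))))"
      by (subst \<phi>(2)) (simp add: \<alpha>_def distrib_left sum_distrib_left mult.assoc)
    then have 1: "(W + c x) * \<phi> x = g x + (\<Sum>p\<in>J. w p x * \<phi> (x + v p))"
      using Wc[of x] by simp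
    have "diffusion \<beta> h \<phi> x = (\<Sum>p\<in>J. w p x * (\<phi> x - \<phi> (x + v p)))"
      unfolding sumJ diffusion_def diffusion_weights[OF \<open>h \<noteq> 0\<close>] by (simp add: w_def v_def)
    also have "\<dots> = W * \<phi> x - (\<Sum>p\<in>J. w p x * \<phi> (x + v p))"
      by (simp add: right_diff_distrib sum_subtractf sum_distrib_right[symmetric] sumw)
    finally show ?thesis using 1 by (simp add: distrib_right)
  qed
  then show ?thesis using \<phi>(1) by blast
qed

section \<open>Consistency of the differences with the derivatives\<close>

lemma partial_deriv_increment':
  fixes f :: "real ^ 'n \<Rightarrow> real"
  assumes "smooth f" "\<And>x. \<bar>partial_deriv i f x\<bar> \<le> B"
  shows "\<bar>f (x + \<tau> *\<^sub>R axis i 1) - f x\<bar> \<le> \<bar>\<tau>\<bar> * B"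
proof (cases "\<tau> \<ge> 0")
  case True
  then show ?thesis using partial_deriv_increment[OF assms(1) _ assms(2), of \<tau> x] by simp
next
  case False
  then show ?thesis
    using partial_deriv_increment[OF assms(1) _ assms(2), of "- \<tau>" "x + \<tau> *\<^sub>R axis i 1"]
    by (simp add: abs_minus_commute)
qed

text \<open>By the mean value theorem the centred difference is a value of the derivative at
  distance below \<open>h\<close> from \<open>x\<close>.\<close>

lemma cdiff_consistent:
  fixes f :: "real ^ 'n \<Rightarrow> real"
  assumes sm: "smooth f" and h: "h > 0" and B: "\<And>x. \<bar>partial_deriv i (partial_deriv i f) x\<bar> \<le> B"
  shows "\<bar>cdiff h i f x - partial_deriv i f x\<bar> \<le> h * B"
proof -
  obtain \<xi> where \<xi>: "0 < \<xi>" "\<xi> < 2 * h"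
    "f ((x - h *\<^sub>R axis i 1) + (2 * h) *\<^sub>R axis i 1) - f (x - h *\<^sub>R axis i 1)
      = 2 * h * partial_deriv i f ((x - h *\<^sub>R axis i 1) + \<xi> *\<^sub>R axis i 1)"
    using partial_deriv_mvt[OF sm, of "2 * h"] h by (metis mult_pos_pos zero_less_numeral)
  have e1: "(x - h *\<^sub>R axis i 1) + (2 * h) *\<^sub>R axis i 1 = x + h *\<^sub>R axis i 1"
    using scaleR_left_distrib[of h h "axis i 1 :: real ^ 'n"] by (simp only: mult_2) simp
  have e2: "(x - h *\<^sub>R axis i 1) + \<xi> *\<^sub>R axis i 1 = x + (\<xi> - h) *\<^sub>R axis i 1"
    by (simp add: scaleR_left_diff_distrib)
  have "cdiff h i f x = partial_deriv i f (x + (\<xi> - h) *\<^sub>R axis i 1)"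
    using \<xi>(3) h unfolding e1 e2 cdiff_def by simp
  moreover have "\<bar>partial_deriv i f (x + (\<xi> - h) *\<^sub>R axis i 1) - partial_deriv i f x\<bar> \<le> \<bar>\<xi> - h\<bar> * B"
    by (rule partial_deriv_increment'[OF smooth_partial_deriv[OF sm] B])
  moreover have "\<bar>\<xi> - h\<bar> * B \<le> h * B"
    using \<xi>(1,2) B[of x] by (intro mult_right_mono) auto
  ultimately show ?thesis by linarith
qed

text \<open>The second difference is the increment of a forward difference over the step ending at
  \<open>x\<close>. Two applications of the mean value theorem give a second derivative at offset
  \<open>\<xi> + \<eta> - h\<close>, which lies between \<open>- h\<close> and
  \<open>h\<close>.\<close>

lemma sdiff_consistent:
  fixes f :: "real ^ 'n \<Rightarrow> real"
  assumes sm: "smooth f" and h: "h > 0"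
    and B: "\<And>x. \<bar>partial_deriv i (partial_deriv i (partial_deriv i f)) x\<bar> \<le> B"
  shows "\<bar>sdiff h i f x - partial_deriv i (partial_deriv i f) x\<bar> \<le> h * B"
proof -
  define k where "k y = f (y + h *\<^sub>R axis i 1) + - 1 * f y" for y
  have s1: "smooth (\<lambda>y. f (y + h *\<^sub>R axis i 1))" using smooth_shift[OF sm] .
  have s2: "smooth (\<lambda>y. - 1 * f y)"
    using sm Ck_mult[OF Ck_const, of _ f "- 1"] unfolding smooth_def by blast
  have sk: "smooth k"
    using s1 s2 Ck_add unfolding k_def[abs_def] smooth_def by blast
  have pk: "partial_deriv i k y = partial_deriv i f (y + h *\<^sub>R axis i 1) - partial_deriv i f y" for y
    using pderivs_add[OF s1 s2, of "[i]"] pderivs_cmult[OF sm, of "[i]" "-1"] pderivs_shift[OF sm, of "[i]"]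
    unfolding k_def[abs_def] by simp
  obtain \<xi> where \<xi>: "0 < \<xi>" "\<xi> < h"
    "k ((x - h *\<^sub>R axis i 1) + h *\<^sub>R axis i 1) - k (x - h *\<^sub>R axis i 1)
      = h * partial_deriv i k ((x - h *\<^sub>R axis i 1) + \<xi> *\<^sub>R axis i 1)"
    using partial_deriv_mvt[OF sk h] by metis
  obtain \<eta> where \<eta>: "0 < \<eta>" "\<eta> < h"
    "partial_deriv i k ((x - h *\<^sub>R axis i 1) + \<xi> *\<^sub>R axis i 1)
      = h * partial_deriv i (partial_deriv i f) (((x - h *\<^sub>R axis i 1) + \<xi> *\<^sub>R axis i 1) + \<eta> *\<^sub>R axis i 1)"
    unfolding pk using partial_deriv_mvt[OF smooth_partial_deriv[OF sm] h] by metis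
  have e: "((x - h *\<^sub>R axis i 1) + \<xi> *\<^sub>R axis i 1) + \<eta> *\<^sub>R axis i 1 = x + (\<xi> + \<eta> - h) *\<^sub>R axis i 1"
    by (simp add: scaleR_left_diff_distrib scaleR_left_distrib)
  have "f (x + h *\<^sub>R axis i 1) + f (x - h *\<^sub>R axis i 1) - 2 * f x
      = k ((x - h *\<^sub>R axis i 1) + h *\<^sub>R axis i 1) - k (x - h *\<^sub>R axis i 1)"
    by (simp add: k_def)
  also have "\<dots> = h\<^sup>2 * partial_deriv i (partial_deriv i f) (x + (\<xi> + \<eta> - h) *\<^sub>R axis i 1)"
    unfolding \<xi>(3) \<eta>(3) e by (simp add: power2_eq_square)
  finally have "sdiff h i f x = partial_deriv i (partial_deriv i f) (x + (\<xi> + \<eta> - h) *\<^sub>R axis i 1)"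
    using h by (simp add: sdiff_def)
  moreover have "\<bar>partial_deriv i (partial_deriv i f) (x + (\<xi> + \<eta> - h) *\<^sub>R axis i 1)
      - partial_deriv i (partial_deriv i f) x\<bar> \<le> \<bar>\<xi> + \<eta> - h\<bar> * B"
    by (rule partial_deriv_increment'[OF smooth_partial_deriv[OF smooth_partial_deriv[OF sm]] B])
  moreover have "\<bar>\<xi> + \<eta> - h\<bar> * B \<le> h * B"
    using \<xi>(1,2) \<eta>(1,2) B[of x] by (intro mult_right_mono) auto
  ultimately show ?thesis by linarith
qed

lemma diffusion_consistent:
  fixes f :: "real ^ 'n \<Rightarrow> real" and B B' :: real
  assumes sm: "smooth f" and h: "h > 0"
    and B: "\<And>i x. \<bar>partial_deriv i (partial_deriv i f) x\<bar> \<le> B"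
      "\<And>i x. \<bar>partial_deriv i (partial_deriv i (partial_deriv i f)) x\<bar> \<le> B"
    and \<beta>: "\<And>i x. \<bar>\<beta> i x\<bar> \<le> B'"
  shows "\<bar>diffusion \<beta> h f x - (\<Sum>i\<in>UNIV. - partial_deriv i (partial_deriv i f) x - \<beta> i x * partial_deriv i f x)\<bar>
      \<le> h * (CARD('n) * (B + B' * B))"
proof -
  have "\<bar>(- sdiff h i f x - \<beta> i x * cdiff h i f x)
      - (- partial_deriv i (partial_deriv i f) x - \<beta> i x * partial_deriv i f x)\<bar> \<le> h * (B + B' * B)" for i
  proof -
    have "\<bar>\<beta> i x * (cdiff h i f x - partial_deriv i f x)\<bar> \<le> B' * (h * B)"
      unfolding abs_mult using \<beta>[of i x] cdiff_consistent[OF sm h B(1)] by (intro mult_mono) auto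
    then have "\<bar>\<beta> i x * cdiff h i f x - \<beta> i x * partial_deriv i f x\<bar> \<le> B' * (h * B)"
      by (simp add: right_diff_distrib)
    moreover have "h * (B + B' * B) = h * B + B' * (h * B)" by (simp add: algebra_simps)
    ultimately show ?thesis using sdiff_consistent[OF sm h B(2), of i x] by linarith
  qed
  then have "\<bar>\<Sum>i\<in>UNIV. (- sdiff h i f x - \<beta> i x * cdiff h i f x)
      - (- partial_deriv i (partial_deriv i f) x - \<beta> i x * partial_deriv i f x)\<bar>
      \<le> (\<Sum>i\<in>(UNIV::'n set). h * (B + B' * B))"
    by (intro order_trans[OF sum_abs] sum_mono)
  then show ?thesis unfolding diffusion_def by (simp add: sum_subtractf mult.left_commute)
qed

lemma elliptic_solution_exists:
  fixes a b :: "real ^ 'n"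
  assumes box: "\<And>i. a $ i < b $ i" and \<beta>: "\<And>i. \<beta> i \<in> Cinf a b"
    and c: "c \<in> Cinf a b" "\<And>x. c x > 0" and g: "g \<in> Cinf a b"
  shows "\<exists>\<phi>\<in>Cinf a b. \<forall>x.
    (\<Sum>i\<in>UNIV. - partial_deriv i (partial_deriv i \<phi>) x - \<beta> i x * partial_deriv i \<phi> x) + c x * \<phi> x = g x"
proof -
  let ?A = "\<lambda>\<phi> x. \<Sum>i\<in>UNIV. - partial_deriv i (partial_deriv i \<phi>) x - \<beta> i x * partial_deriv i \<phi> x"
  obtain c0 where c0: "c0 > 0" "\<And>x. c0 \<le> c x" using Cinf_pos_lower_bound[OF box c] by blast
  have "\<forall>i. \<exists>M\<ge>0. \<forall>x. \<bar>\<beta> i x\<bar> \<le> M" using Cinf_bounded[OF box \<beta>] by blast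
  from choice[OF this] obtain M where M: "\<forall>i. 0 \<le> M i \<and> (\<forall>x. \<bar>\<beta> i x\<bar> \<le> M i)" ..
  define B' where "B' = (\<Sum>i\<in>UNIV. M i)"
  have B'0: "B' \<ge> 0" unfolding B'_def using M by (intro sum_nonneg) auto
  have B': "\<bar>\<beta> i x\<bar> \<le> B'" for i x
  proof -
    have "M i \<le> B'" unfolding B'_def using M by (intro member_le_sum) auto
    then show ?thesis using M order_trans by blast
  qed
  \<comment> \<open>The first factor enforces the smallness condition against every
    \<open>\<beta> i\<close>; the second sends the step to 0.\<close>
  define h where "h k = inverse (B' + 1) * inverse (real (Suc k))" for k
  have h0: "h k > 0" for k using B'0 by (simp add: h_def)
  have h\<beta>: "h k * \<bar>\<beta> i x\<bar> \<le> 1" for k i x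
  proof -
    have "h k * \<bar>\<beta> i x\<bar> \<le> inverse (B' + 1) * 1 * (B' + 1)"
      unfolding h_def using B'0 B'[of i x]
      by (intro mult_mono mult_left_mono) (auto simp: field_simps)
    then show ?thesis using B'0 by simp
  qed
  have h_lim: "h \<longlonglongrightarrow> 0"
    unfolding h_def[abs_def] using tendsto_mult_right_zero[OF LIMSEQ_inverse_real_of_nat] .
  have "\<forall>k. \<exists>\<phi>. \<phi> \<in> Cinf a b \<and> (\<forall>x. diffusion \<beta> (h k) \<phi> x + c x * \<phi> x = g x)"
    using diffusion_solution_exists[where \<beta>=\<beta>, OF box \<beta> c(1) c0 g h0 h\<beta>] by blast
  from choice[OF this] obtain \<phi> where
    \<phi>': "\<forall>k. \<phi> k \<in> Cinf a b \<and> (\<forall>x. diffusion \<beta> (h k) (\<phi> k) x + c x * \<phi> k x = g x)" ..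
  then have \<phi>: "\<phi> k \<in> Cinf a b" and \<phi>eq: "diffusion \<beta> (h k) (\<phi> k) x + c x * \<phi> k x = g x" for k x
    by blast+
  have bound: "\<exists>M. \<forall>k x. \<bar>pderivs is (\<phi> k) x\<bar> \<le> M" for "is"
  proof -
    obtain M where "\<forall>h. \<forall>\<phi>\<in>Cinf a b. h > 0 \<longrightarrow> (\<forall>i x. h * \<bar>\<beta> i x\<bar> \<le> 1) \<longrightarrow>
      (\<forall>x. diffusion \<beta> h \<phi> x + c x * \<phi> x = g x) \<longrightarrow> (\<forall>x. \<bar>pderivs is \<phi> x\<bar> \<le> M)"
      using solution_pderivs_bound[where \<beta>=\<beta> and c=c and g=g, OF box \<beta> c(1) c0 g] by blast
    then have "\<bar>pderivs is (\<phi> k) x\<bar> \<le> M" for k x using \<phi> h0 h\<beta> \<phi>eq by blast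
    then show ?thesis by blast
  qed
  have "\<forall>is. \<exists>M. \<forall>k x. \<bar>pderivs is (\<phi> k) x\<bar> \<le> M" using bound by blast
  from choice[OF this] obtain N where N: "\<forall>is k x. \<bar>pderivs is (\<phi> k) x\<bar> \<le> N is" ..
  \<comment> \<open>The consistency error uses pure second and third derivatives; one bound for all
    of them, uniform in \<open>k\<close>, makes that error linear in the step.\<close>
  define B where "B = (\<Sum>i\<in>UNIV. \<bar>N [i, i]\<bar> + \<bar>N [i, i, i]\<bar>)"
  have NB: "\<bar>N [i, i]\<bar> + \<bar>N [i, i, i]\<bar> \<le> B" for i
    unfolding B_def by (rule member_le_sum[where f="\<lambda>i. \<bar>N [i, i]\<bar> + \<bar>N [i, i, i]\<bar>"]) auto
  have B: "\<bar>partial_deriv i (partial_deriv i (\<phi> k)) x\<bar> \<le> B"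
    "\<bar>partial_deriv i (partial_deriv i (partial_deriv i (\<phi> k))) x\<bar> \<le> B" for i k x
    using N[rule_format, of "[i, i]" k x] N[rule_format, of "[i, i, i]" k x] NB[of i]
    unfolding pderivs_simps by linarith+
  define E where "E = CARD('n) * (B + B' * B)"
  have cons: "\<bar>diffusion \<beta> (h m) (\<phi> k) x - ?A (\<phi> k) x\<bar> \<le> h m * E" for m k x
    unfolding E_def by (rule diffusion_consistent[OF Cinf_smooth[OF \<phi>] h0 B B'])
  \<comment> \<open>Solutions with different steps are compared through the scheme with step
    \<open>h m\<close>. Applied to their difference it leaves the discrepancy of two schemes on the
    single function \<open>\<phi> k\<close>, and both schemes are close to the differential operator
    there.\<close>
  have diff: "\<bar>\<phi> m x - \<phi> k x\<bar> \<le> (h m + h k) * E / c0" for m k x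
  proof (rule diffusion_maximum_principle[where \<psi>="\<lambda>x. \<phi> m x - \<phi> k x", OF box h0[of m] h\<beta>[of m] c0 Cinf_diff[OF \<phi> \<phi>]])
    fix x
    have "diffusion \<beta> (h m) (\<lambda>x. \<phi> m x - \<phi> k x) x = diffusion \<beta> (h m) (\<phi> m) x - diffusion \<beta> (h m) (\<phi> k) x"
      using diffusion_add[of \<beta> "h m" "\<phi> m" "\<lambda>x. - 1 * \<phi> k x" x] diffusion_cmult[of \<beta> "h m" "-1" "\<phi> k" x] by simp
    then have "diffusion \<beta> (h m) (\<lambda>x. \<phi> m x - \<phi> k x) x + c x * (\<phi> m x - \<phi> k x)
        = diffusion \<beta> (h k) (\<phi> k) x - diffusion \<beta> (h m) (\<phi> k) x"
      using \<phi>eq[of m x] \<phi>eq[of k x] by (simp add: right_diff_distrib)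
    then show "\<bar>diffusion \<beta> (h m) (\<lambda>x. \<phi> m x - \<phi> k x) x + c x * (\<phi> m x - \<phi> k x)\<bar> \<le> (h m + h k) * E"
      using cons[of k k x] cons[of m k x] unfolding distrib_right by linarith
  qed
  have hE: "(\<lambda>k. h k * E / c0) \<longlonglongrightarrow> 0"
    using tendsto_mult_left_zero[OF h_lim, of "E / c0"] by simp
  have "uniformly_Cauchy_on UNIV \<phi>"
  proof (rule uniformly_Cauchy_onI)
    fix e :: real assume "e > 0"
    then have "\<forall>\<^sub>F k in sequentially. h k * E / c0 < e / 2"
      using hE by (intro order_tendstoD(2)) auto
    then obtain K where K: "\<And>k. k \<ge> K \<Longrightarrow> h k * E / c0 < e / 2"
      unfolding eventually_sequentially by blast
    have "dist (\<phi> m x) (\<phi> k x) < e" if "m \<ge> K" "k \<ge> K" for m k x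
      using diff[of m x k] K[OF that(1)] K[OF that(2)]
      unfolding dist_real_def distrib_right add_divide_distrib by linarith
    then show "\<exists>M. \<forall>x\<in>UNIV. \<forall>m\<ge>M. \<forall>n\<ge>M. dist (\<phi> m x) (\<phi> n x) < e" by blast
  qed
  from Cinf_limit[OF \<phi> this bound] obtain \<psi> where \<psi>: "\<psi> \<in> Cinf a b"
    "\<And>is. uniform_limit UNIV (\<lambda>k. pderivs is (\<phi> k)) (pderivs is \<psi>) sequentially" by blast
  have lim: "(\<lambda>k. pderivs is (\<phi> k) x) \<longlonglongrightarrow> pderivs is \<psi> x" for "is" x
    using tendsto_uniform_limitI[OF \<psi>(2)] by blast
  have "?A \<psi> x + c x * \<psi> x = g x" for x
  proof (rule LIMSEQ_unique)
    show "(\<lambda>k. ?A (\<phi> k) x + c x * \<phi> k x) \<longlonglongrightarrow> ?A \<psi> x + c x * \<psi> x"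
      using lim[of "[_, _]" x] lim[of "[_]" x] lim[of "[]" x]
      by (intro tendsto_intros) simp_all
    \<comment> \<open>Consistency at its own step bounds the residual of \<open>\<phi> k\<close> in
      the differential equation by \<open>h k * E\<close>.\<close>
    have "(\<lambda>k. (?A (\<phi> k) x + c x * \<phi> k x) - g x) \<longlonglongrightarrow> 0"
    proof (rule Lim_null_comparison)
      show "(\<lambda>k. h k * E) \<longlonglongrightarrow> 0" using tendsto_mult_left_zero[OF h_lim] .
      have "norm ((?A (\<phi> k) x + c x * \<phi> k x) - g x) \<le> h k * E" for k
        using cons[of k k x] \<phi>eq[of k x] unfolding real_norm_def by linarith
      then show "\<forall>\<^sub>F k in sequentially. norm ((?A (\<phi> k) x + c x * \<phi> k x) - g x) \<le> h k * E" by simp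
    qed
    then show "(\<lambda>k. ?A (\<phi> k) x + c x * \<phi> k x) \<longlonglongrightarrow> g x" by (rule LIM_zero_cancel)
  qed
  then show ?thesis using \<psi>(1) by blast
qed

section \<open>Return to divergence form\<close>

lemma elliptic_op_eq:
  "elliptic_op V1 V2 u \<phi> x
    = - (\<Sum>i\<in>UNIV. partial_deriv i (\<lambda>y. V1 (u y) * partial_deriv i \<phi> y) x) + V2 (u x) * \<phi> x"
  by (simp add: elliptic_op_def divergence_def gradient_def)

lemma Cinf_elliptic_op:
  assumes "(\<lambda>x. V1 (u x)) \<in> Cinf a b" "(\<lambda>x. V2 (u x)) \<in> Cinf a b" "\<phi> \<in> Cinf a b"
  shows "elliptic_op V1 V2 u \<phi> \<in> Cinf a b"
  unfolding elliptic_op_eq[abs_def]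
  by (intro Cinf_add Cinf_minus Cinf_sum Cinf_partial_deriv Cinf_mult assms)

text \<open>Expanding the divergence and dividing by \<open>V1(u)\<close> gives minus the Laplacian,
  a drift equal to the logarithmic gradient of \<open>V1(u)\<close>, and the positive zero-order
  coefficient \<open>V2(u) / V1(u)\<close>.\<close>

lemma elliptic_op_surj:
  fixes a b :: "real ^ 'n"
  assumes box: "\<And>i. a $ i < b $ i"
    and p: "(\<lambda>x. V1 (u x)) \<in> Cinf a b" "\<And>x. V1 (u x) > 0"
    and q: "(\<lambda>x. V2 (u x)) \<in> Cinf a b" "\<And>x. V2 (u x) > 0"
    and f: "f \<in> Cinf a b"
  shows "f \<in> elliptic_op V1 V2 u ` Cinf a b"
proof -
  let ?p = "\<lambda>x. V1 (u x)"
  have invp: "(\<lambda>x. inverse (?p x)) \<in> Cinf a b" using Cinf_inverse p by blast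
  obtain \<phi> where \<phi>: "\<phi> \<in> Cinf a b" and eq: "\<And>x. (\<Sum>i\<in>UNIV. - partial_deriv i (partial_deriv i \<phi>) x
      - inverse (?p x) * partial_deriv i ?p x * partial_deriv i \<phi> x)
      + inverse (?p x) * V2 (u x) * \<phi> x = inverse (?p x) * f x"
    using elliptic_solution_exists[of a b "\<lambda>i x. inverse (?p x) * partial_deriv i ?p x"
        "\<lambda>x. inverse (?p x) * V2 (u x)" "\<lambda>x. inverse (?p x) * f x",
        OF box Cinf_mult[OF invp Cinf_partial_deriv[OF p(1)]] Cinf_mult[OF invp q(1)] _ Cinf_mult[OF invp f]]
      p(2) q(2) by auto
  have "elliptic_op V1 V2 u \<phi> x = f x" for x
  proof -
    have "partial_deriv i (\<lambda>y. ?p y * partial_deriv i \<phi> y) x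
        = partial_deriv i ?p x * partial_deriv i \<phi> x + ?p x * partial_deriv i (partial_deriv i \<phi>) x" for i
      by (intro partial_deriv_mult smooth_differentiable Cinf_smooth[of _ a b] p Cinf_partial_deriv \<phi>)
    then have "elliptic_op V1 V2 u \<phi> x = - (\<Sum>i\<in>UNIV. partial_deriv i ?p x * partial_deriv i \<phi> x
        + ?p x * partial_deriv i (partial_deriv i \<phi>) x) + V2 (u x) * \<phi> x"
      by (simp add: elliptic_op_eq)
    also have "\<dots> = ?p x * ((\<Sum>i\<in>UNIV. - partial_deriv i (partial_deriv i \<phi>) x
      - inverse (?p x) * partial_deriv i ?p x * partial_deriv i \<phi> x)
      + inverse (?p x) * V2 (u x) * \<phi> x)"
    proof -
      have "?p x * inverse (?p x) = 1" using p(2)[of x] by simp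
      then have cancel: "?p x * (inverse (?p x) * z) = z" for z by (metis mult.assoc mult_1)
      show ?thesis
        by (simp add: cancel distrib_left right_diff_distrib sum_distrib_left sum.distrib sum_subtractf sum_negf mult.assoc)
    qed
    also have "\<dots> = f x" unfolding eq using p(2)[of x] by simp
    finally show ?thesis .
  qed
  then have "elliptic_op V1 V2 u \<phi> = f" by blast
  then show ?thesis using \<phi> by blast
qed

subsection \<open>Integration by parts on the torus\<close>

lemma Cinf_integrable: "f \<in> Cinf a b \<Longrightarrow> f integrable_on cbox p q"
  using integrable_continuous smooth_continuous Cinf_smooth by blast

lemma integral_cbox_shift:
  fixes f :: "real ^ 'n \<Rightarrow> real"
  assumes "f integrable_on cbox (p + v) (q + v)"
  shows "integral (cbox p q) (\<lambda>x. f (x + v)) = integral (cbox (p + v) (q + v)) f"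
  using has_integral_affinity'[OF integrable_integral[OF assms], of 1 v] integral_unique by simp

text \<open>The slab of the translated box that sticks out beyond the upper face is one period away
  from the slab left behind at the lower face.\<close>

lemma integral_periodic_shift:
  fixes a b :: "real ^ 'n"
  assumes box: "\<And>i. a $ i < b $ i" and f: "f \<in> Cinf a b" and s: "0 \<le> s" "s \<le> b $ i - a $ i"
  shows "integral (cbox a b) (\<lambda>x. f (x + s *\<^sub>R axis i 1)) = integral (cbox a b) f"
proof -
  define v where "v = s *\<^sub>R axis i (1::real)"
  define w where "w = axis i (b $ i - a $ i)"
  \<comment> \<open>Upper corner of the slab of thickness \<open>s\<close> at the lower face;
    translation by \<open>w\<close> carries this slab to the protruding one.\<close>
  define q where "q = (\<chi> j. if j = i then a $ i + s else b $ j)"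
  have v: "v $ j = (if j = i then s else 0)" for j by (simp add: v_def axis_def)
  have w: "w $ j = (if j = i then b $ i - a $ i else 0)" for j by (simp add: w_def axis_def)
  have k: "axis i (1::real) \<in> Basis" by (simp add: axis_in_Basis_iff)
  have inner: "x \<bullet> axis i 1 = x $ i" for x :: "real ^ 'n" by (simp add: inner_axis)
  have A1: "cbox a b \<inter> {x. x $ i \<le> a $ i + s} = cbox a q"
  proof (intro set_eqI)
    fix x
    have "x \<in> cbox a q \<longleftrightarrow> (\<forall>j. a $ j \<le> x $ j \<and> x $ j \<le> (if j = i then a $ i + s else b $ j))"
      by (simp add: mem_box_cart q_def)
    also have "\<dots> \<longleftrightarrow> (\<forall>j. a $ j \<le> x $ j \<and> x $ j \<le> b $ j) \<and> x $ i \<le> a $ i + s"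
      using s by (smt (verit))
    finally show "x \<in> cbox a b \<inter> {x. x $ i \<le> a $ i + s} \<longleftrightarrow> x \<in> cbox a q"
      by (simp add: mem_box_cart)
  qed
  have A2: "cbox a b \<inter> {x. a $ i + s \<le> x $ i} = cbox (a + v) (b + v) \<inter> {x. x $ i \<le> b $ i}"
  proof (intro set_eqI)
    fix x
    have "x \<in> cbox (a + v) (b + v) \<inter> {x. x $ i \<le> b $ i}
      \<longleftrightarrow> (\<forall>j. a $ j + (if j = i then s else 0) \<le> x $ j \<and> x $ j \<le> b $ j + (if j = i then s else 0)) \<and> x $ i \<le> b $ i"
      by (simp add: mem_box_cart v)
    also have "\<dots> \<longleftrightarrow> (\<forall>j. a $ j \<le> x $ j \<and> x $ j \<le> b $ j) \<and> a $ i + s \<le> x $ i"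
      using s by (smt (verit))
    finally show "x \<in> cbox a b \<inter> {x. a $ i + s \<le> x $ i} \<longleftrightarrow> x \<in> cbox (a + v) (b + v) \<inter> {x. x $ i \<le> b $ i}"
      by (simp add: mem_box_cart)
  qed
  have A3: "cbox (a + v) (b + v) \<inter> {x. b $ i \<le> x $ i} = cbox (a + w) (q + w)"
  proof (intro set_eqI)
    fix x
    have "x \<in> cbox (a + v) (b + v) \<inter> {x. b $ i \<le> x $ i}
      \<longleftrightarrow> (\<forall>j. a $ j + (if j = i then s else 0) \<le> x $ j \<and> x $ j \<le> b $ j + (if j = i then s else 0)) \<and> b $ i \<le> x $ i"
      by (simp add: mem_box_cart v)
    also have "\<dots> \<longleftrightarrow> (\<forall>j. (if j = i then b $ i else a $ j) \<le> x $ j \<and> x $ j \<le> (if j = i then b $ i + s else b $ j))"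
      using s by (smt (verit))
    also have "\<dots> \<longleftrightarrow> x \<in> cbox (a + w) (q + w)"
      by (simp add: mem_box_cart w q_def) (smt (verit))
    finally show "x \<in> cbox (a + v) (b + v) \<inter> {x. b $ i \<le> x $ i} \<longleftrightarrow> x \<in> cbox (a + w) (q + w)" .
  qed
  have per: "(\<lambda>x. f (x + w)) = f"
    using f by (auto simp: w_def Cinf_def box_periodic_def)
  have "integral (cbox a b) (\<lambda>x. f (x + v)) = integral (cbox (a + v) (b + v)) f"
    by (rule integral_cbox_shift[OF Cinf_integrable[OF f]])
  also have "\<dots> = integral (cbox (a + v) (b + v) \<inter> {x. x $ i \<le> b $ i}) f + integral (cbox (a + w) (q + w)) f"
    using integral_split[OF Cinf_integrable[OF f] k, of "a + v" "b + v" "b $ i"] unfolding inner A3 .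
  also have "integral (cbox (a + w) (q + w)) f = integral (cbox a q) f"
    using integral_cbox_shift[OF Cinf_integrable[OF f], of a q w] unfolding per by simp
  also have "integral (cbox (a + v) (b + v) \<inter> {x. x $ i \<le> b $ i}) f + integral (cbox a q) f = integral (cbox a b) f"
    using integral_split[OF Cinf_integrable[OF f] k, of a b "a $ i + s"] unfolding inner A1 A2 by simp
  finally show ?thesis unfolding v_def .
qed

text \<open>A difference quotient integrates to 0 by translation invariance and is uniformly within
  \<open>h * B\<close> of the partial derivative; \<open>h\<close> then tends to 0.\<close>

lemma integral_partial_deriv:
  fixes a b :: "real ^ 'n"
  assumes box: "\<And>i. a $ i < b $ i" and f: "f \<in> Cinf a b"
  shows "integral (cbox a b) (partial_deriv i f) = 0"
proof -
  let ?I = "integral (cbox a b)" and ?e = "axis i (1::real)"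
  have sm: "smooth f" using f Cinf_smooth by blast
  have f': "partial_deriv i f \<in> Cinf a b" using f by (rule Cinf_partial_deriv)
  obtain B where B: "B \<ge> 0" "\<And>x. \<bar>partial_deriv i (partial_deriv i f) x\<bar> \<le> B"
    using Cinf_bounded[OF box Cinf_partial_deriv[OF f']] by blast
  have key: "\<bar>?I (partial_deriv i f)\<bar> \<le> h * (B * measure lborel (cbox a b))" if h: "0 < h" "h \<le> b $ i - a $ i" for h
  proof -
    let ?g = "\<lambda>x. h * partial_deriv i f x - (f (x + h *\<^sub>R ?e) - f x)"
    have "norm (?g x) \<le> h * (h * B)" for x
    proof -
      obtain \<xi> where \<xi>: "0 < \<xi>" "\<xi> < h" "f (x + h *\<^sub>R ?e) - f x = h * partial_deriv i f (x + \<xi> *\<^sub>R ?e)"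
        using partial_deriv_mvt[OF sm h(1)] by metis
      have "\<bar>partial_deriv i f (x + \<xi> *\<^sub>R ?e) - partial_deriv i f x\<bar> \<le> \<xi> * B"
        using partial_deriv_increment[OF smooth_partial_deriv[OF sm] _ B(2), of \<xi> x] \<xi> by simp
      also have "\<dots> \<le> h * B" using \<xi> B(1) by (intro mult_right_mono) auto
      finally have "h * \<bar>partial_deriv i f (x + \<xi> *\<^sub>R ?e) - partial_deriv i f x\<bar> \<le> h * (h * B)"
        using h(1) by (intro mult_left_mono) auto
      moreover have "?g x = - (h * (partial_deriv i f (x + \<xi> *\<^sub>R ?e) - partial_deriv i f x))"
        unfolding \<xi>(3) by (simp add: right_diff_distrib)
      ultimately show ?thesis using h(1) by (simp add: abs_mult)
    qed
    moreover have "?g integrable_on cbox a b"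
      by (rule Cinf_integrable[of _ a b]) (intro Cinf_diff Cinf_mult Cinf_const Cinf_shift f f')
    ultimately have "norm (?I ?g) \<le> h * (h * B) * measure lborel (cbox a b)"
      using B(1) h(1) by (intro integrable_bound) auto
    moreover have "?I ?g = h * ?I (partial_deriv i f)"
    proof -
      have "?I ?g = ?I (\<lambda>x. h * partial_deriv i f x) - ?I (\<lambda>x. f (x + h *\<^sub>R ?e) - f x)"
        by (intro integral_diff Cinf_integrable[of _ a b] Cinf_diff Cinf_mult Cinf_const Cinf_shift f f')
      also have "?I (\<lambda>x. f (x + h *\<^sub>R ?e) - f x) = ?I (\<lambda>x. f (x + h *\<^sub>R ?e)) - ?I f"
        by (intro integral_diff Cinf_integrable[of _ a b] Cinf_shift f)
      also have "\<dots> = 0" using integral_periodic_shift[OF box f, of h i] h by simp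
      finally show ?thesis by simp
    qed
    ultimately have "h * \<bar>?I (partial_deriv i f)\<bar> \<le> h * (h * (B * measure lborel (cbox a b)))"
      using h(1) by (simp add: abs_mult mult.assoc)
    then show ?thesis using h(1) by simp
  qed
  have "((\<lambda>h. h * (B * measure lborel (cbox a b))) \<longlongrightarrow> 0 * (B * measure lborel (cbox a b))) (at_right 0)"
    by (intro tendsto_intros)
  moreover have "\<forall>\<^sub>F h in at_right 0. \<bar>?I (partial_deriv i f)\<bar> \<le> h * (B * measure lborel (cbox a b))"
    unfolding eventually_at_right_field
    using box[of i] key by (intro exI[of _ "b $ i - a $ i"]) auto
  ultimately have "\<bar>?I (partial_deriv i f)\<bar> \<le> 0 * (B * measure lborel (cbox a b))"
    by (intro tendsto_lowerbound[of _ _ "at_right (0::real)"]) auto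
  then show ?thesis by simp
qed

text \<open>The two integrands differ by the divergence of \<open>\<psi>\<close> times the flux, a
  sum of partial derivatives of periodic functions.\<close>

lemma elliptic_op_green:
  fixes a b :: "real ^ 'n"
  assumes box: "\<And>i. a $ i < b $ i"
    and p: "(\<lambda>x. V1 (u x)) \<in> Cinf a b" and q: "(\<lambda>x. V2 (u x)) \<in> Cinf a b"
    and \<phi>: "\<phi> \<in> Cinf a b" and \<psi>: "\<psi> \<in> Cinf a b"
  shows "integral (cbox a b) (\<lambda>x. \<psi> x * elliptic_op V1 V2 u \<phi> x)
    = integral (cbox a b) (\<lambda>x. V1 (u x) * (gradient \<phi> x \<bullet> gradient \<psi> x) + V2 (u x) * \<phi> x * \<psi> x)"
proof -
  let ?F = "\<lambda>i x. V1 (u x) * partial_deriv i \<phi> x"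
  have FC: "?F i \<in> Cinf a b" for i by (intro Cinf_mult Cinf_partial_deriv p \<phi>)
  have GC: "partial_deriv i (\<lambda>x. \<psi> x * ?F i x) \<in> Cinf a b" for i by (intro Cinf_partial_deriv Cinf_mult \<psi> FC)
  have EC: "(\<lambda>x. V1 (u x) * (gradient \<phi> x \<bullet> gradient \<psi> x) + V2 (u x) * \<phi> x * \<psi> x) \<in> Cinf a b"
    unfolding inner_vec_def gradient_def
    by (simp, intro Cinf_add Cinf_mult Cinf_sum Cinf_partial_deriv p q \<phi> \<psi>)
  have "\<psi> x * elliptic_op V1 V2 u \<phi> x = (V1 (u x) * (gradient \<phi> x \<bullet> gradient \<psi> x) + V2 (u x) * \<phi> x * \<psi> x)
      - (\<Sum>i\<in>UNIV. partial_deriv i (\<lambda>x. \<psi> x * ?F i x) x)" for x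
  proof -
    have "partial_deriv i (\<lambda>x. \<psi> x * ?F i x) x = partial_deriv i \<psi> x * ?F i x + \<psi> x * partial_deriv i (?F i) x" for i
      by (intro partial_deriv_mult smooth_differentiable Cinf_smooth[of _ a b] \<psi> FC)
    then show ?thesis
      by (simp add: elliptic_op_eq inner_vec_def gradient_def sum.distrib sum_distrib_left algebra_simps)
  qed
  then have "integral (cbox a b) (\<lambda>x. \<psi> x * elliptic_op V1 V2 u \<phi> x)
      = integral (cbox a b) (\<lambda>x. V1 (u x) * (gradient \<phi> x \<bullet> gradient \<psi> x) + V2 (u x) * \<phi> x * \<psi> x)
        - integral (cbox a b) (\<lambda>x. \<Sum>i\<in>UNIV. partial_deriv i (\<lambda>x. \<psi> x * ?F i x) x)"
    by (simp only:) (intro integral_diff Cinf_integrable[of _ a b] EC Cinf_sum GC)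
  also have "integral (cbox a b) (\<lambda>x. \<Sum>i\<in>UNIV. partial_deriv i (\<lambda>x. \<psi> x * ?F i x) x)
      = (\<Sum>i\<in>UNIV. integral (cbox a b) (\<lambda>x. partial_deriv i (\<lambda>x. \<psi> x * ?F i x) x))"
    by (intro integral_sum Cinf_integrable[OF GC]) auto
  also have "\<dots> = 0" using integral_partial_deriv[OF box Cinf_mult[OF \<psi> FC]] by simp
  finally show ?thesis by simp
qed

subsection \<open>The Hamiltonian\<close>

lemma hamiltonian_eq:
  fixes a b :: "real ^ 'n"
  assumes box: "\<And>i. a $ i < b $ i"
    and p: "(\<lambda>x. V1 (u x)) \<in> Cinf a b" "\<And>x. V1 (u x) > 0"
    and q: "(\<lambda>x. V2 (u x)) \<in> Cinf a b" "\<And>x. V2 (u x) > 0"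
    and \<Phi>: "\<Phi> \<in> Cinf a b"
  shows "hamiltonian a b (\<lambda>u \<sigma>. 1/2 * mf_metric a b V1 V2 u \<sigma> \<sigma> - \<F> u) u \<Phi>
    = ereal (1/2 * integral (cbox a b) (\<lambda>x. (norm (gradient \<Phi> x))\<^sup>2 * V1 (u x))
        + 1/2 * integral (cbox a b) (\<lambda>x. \<bar>\<Phi> x\<bar>\<^sup>2 * V2 (u x)) + \<F> u)"
proof -
  let ?A = "elliptic_op V1 V2 u"
  define e where "e \<phi> \<psi> x = V1 (u x) * (gradient \<phi> x \<bullet> gradient \<psi> x) + V2 (u x) * \<phi> x * \<psi> x" for \<phi> \<psi> x
  define E where "E \<phi> \<psi> = integral (cbox a b) (e \<phi> \<psi>)" for \<phi> \<psi>
  have eC: "e \<phi> \<psi> \<in> Cinf a b" if "\<phi> \<in> Cinf a b" "\<psi> \<in> Cinf a b" for \<phi> \<psi>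
    unfolding e_def[abs_def] inner_vec_def gradient_def
    by (simp, intro Cinf_add Cinf_mult Cinf_sum Cinf_partial_deriv p q that)
  have green: "integral (cbox a b) (\<lambda>x. \<psi> x * ?A \<phi> x) = E \<phi> \<psi>" if "\<phi> \<in> Cinf a b" "\<psi> \<in> Cinf a b" for \<phi> \<psi>
    unfolding E_def e_def[abs_def] by (rule elliptic_op_green[OF box p(1) q(1) that])
  have sym: "E \<phi> \<psi> = E \<psi> \<phi>" for \<phi> \<psi>
    unfolding E_def e_def[abs_def] by (simp add: inner_commute ac_simps)
  define inv where "inv = inv_into (Cinf a b) ?A"
  \<comment> \<open>Surjectivity makes \<open>inv_into\<close> a right inverse on all of
    \<open>Cinf a b\<close>, so every \<open>\<sigma>\<close> can be replaced by a preimage.\<close>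
  have inv: "inv \<sigma> \<in> Cinf a b" "?A (inv \<sigma>) = \<sigma>" if "\<sigma> \<in> Cinf a b" for \<sigma>
    using elliptic_op_surj[where u=u, OF box p q that] inv_into_into f_inv_into_f
    unfolding inv_def by metis+
  have val: "integral (cbox a b) (\<lambda>x. \<Phi> x * \<sigma> x) - (1/2 * mf_metric a b V1 V2 u \<sigma> \<sigma> - \<F> u)
      = E (inv \<sigma>) \<Phi> - 1/2 * E (inv \<sigma>) (inv \<sigma>) + \<F> u" if \<sigma>: "\<sigma> \<in> Cinf a b" for \<sigma>
  proof -
    have "integral (cbox a b) (\<lambda>x. \<Phi> x * \<sigma> x) = E (inv \<sigma>) \<Phi>"
      using green[OF inv(1)[OF \<sigma>] \<Phi>] inv(2)[OF \<sigma>] by simp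
    moreover have "mf_metric a b V1 V2 u \<sigma> \<sigma> = E (inv \<sigma>) (inv \<sigma>)"
      using green[OF inv(1)[OF \<sigma>] inv(1)[OF \<sigma>]] inv(2)[OF \<sigma>]
      by (simp add: mf_metric_def inv_def[symmetric] mult.commute)
    ultimately show ?thesis by simp
  qed
  have le: "E \<phi> \<Phi> - 1/2 * E \<phi> \<phi> \<le> 1/2 * E \<Phi> \<Phi>" if \<phi>: "\<phi> \<in> Cinf a b" for \<phi>
  proof -
    have int: "e \<phi> \<psi> integrable_on cbox a b" if "\<phi> \<in> Cinf a b" "\<psi> \<in> Cinf a b" for \<phi> \<psi>
      using eC[OF that] by (rule Cinf_integrable)
    have "0 \<le> integral (cbox a b) (\<lambda>x. e \<Phi> \<Phi> x - 2 * e \<phi> \<Phi> x + e \<phi> \<phi> x)"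
    proof (rule integral_nonneg)
      show "(\<lambda>x. e \<Phi> \<Phi> x - 2 * e \<phi> \<Phi> x + e \<phi> \<phi> x) integrable_on cbox a b"
        by (rule Cinf_integrable[of _ a b]) (intro Cinf_add Cinf_diff Cinf_mult Cinf_const eC \<phi> \<Phi>)
      \<comment> \<open>The square is completed pointwise in the integrand, where positivity of both
        coefficients is available.\<close>
      have "e \<Phi> \<Phi> x - 2 * e \<phi> \<Phi> x + e \<phi> \<phi> x
          = V1 (u x) * ((gradient \<Phi> x - gradient \<phi> x) \<bullet> (gradient \<Phi> x - gradient \<phi> x)) + V2 (u x) * (\<Phi> x - \<phi> x)\<^sup>2" for x
        unfolding e_def by (simp add: inner_diff inner_commute power2_eq_square algebra_simps)
      then show "0 \<le> e \<Phi> \<Phi> x - 2 * e \<phi> \<Phi> x + e \<phi> \<phi> x" for x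
        using p(2)[of x] q(2)[of x] by simp
    qed
    also have "\<dots> = E \<Phi> \<Phi> - 2 * E \<phi> \<Phi> + E \<phi> \<phi>"
      using int[OF \<Phi> \<Phi>] int[OF \<phi> \<Phi>] int[OF \<phi> \<phi>]
      by (simp add: E_def integral_add integral_diff integrable_diff integrable_on_cmult_left)
    finally show ?thesis by simp
  qed
  have AC: "?A \<Phi> \<in> Cinf a b" using Cinf_elliptic_op[OF p(1) q(1) \<Phi>] .
  \<comment> \<open>The preimage selected by \<open>inv\<close> is not identified with
    \<open>\<Phi>\<close>. Green's formula expresses \<open>E\<close> through the image of its first
    argument, and symmetry of \<open>E\<close> then equates all the energies involved.\<close>
  define \<phi>0 where "\<phi>0 = inv (?A \<Phi>)"
  have \<phi>0: "\<phi>0 \<in> Cinf a b" "?A \<phi>0 = ?A \<Phi>" using inv[OF AC] by (auto simp: \<phi>0_def)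
  have "E \<phi>0 \<Phi> = E \<Phi> \<Phi>" using green[OF \<phi>0(1) \<Phi>] green[OF \<Phi> \<Phi>] \<phi>0(2) by simp
  moreover have "E \<phi>0 \<phi>0 = E \<Phi> \<Phi>"
    using green[OF \<phi>0(1) \<phi>0(1)] green[OF \<Phi> \<phi>0(1)] \<phi>0(2) sym calculation by simp
  ultimately have attained: "E \<phi>0 \<Phi> - 1/2 * E \<phi>0 \<phi>0 + \<F> u = 1/2 * E \<Phi> \<Phi> + \<F> u" by simp
  have "hamiltonian a b (\<lambda>u \<sigma>. 1/2 * mf_metric a b V1 V2 u \<sigma> \<sigma> - \<F> u) u \<Phi> = ereal (1/2 * E \<Phi> \<Phi> + \<F> u)"
    unfolding hamiltonian_def
  proof (rule antisym)
    show "(SUP \<sigma>\<in>Cinf a b. ereal (integral (cbox a b) (\<lambda>x. \<Phi> x * \<sigma> x)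
        - (1/2 * mf_metric a b V1 V2 u \<sigma> \<sigma> - \<F> u))) \<le> ereal (1/2 * E \<Phi> \<Phi> + \<F> u)"
      by (rule SUP_least) (use le inv(1) val in \<open>auto simp del: ereal_less_eq simp: ereal_less_eq(3)\<close>)
    show "ereal (1/2 * E \<Phi> \<Phi> + \<F> u) \<le> (SUP \<sigma>\<in>Cinf a b. ereal (integral (cbox a b) (\<lambda>x. \<Phi> x * \<sigma> x)
        - (1/2 * mf_metric a b V1 V2 u \<sigma> \<sigma> - \<F> u)))"
      using AC val[OF AC] attained unfolding \<phi>0_def by (intro SUP_upper2[of "?A \<Phi>"]) auto
  qed
  also have "E \<Phi> \<Phi> = integral (cbox a b) (\<lambda>x. (norm (gradient \<Phi> x))\<^sup>2 * V1 (u x))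
      + integral (cbox a b) (\<lambda>x. \<bar>\<Phi> x\<bar>\<^sup>2 * V2 (u x))"
  proof -
    have "e \<Phi> \<Phi> = (\<lambda>x. (norm (gradient \<Phi> x))\<^sup>2 * V1 (u x) + \<bar>\<Phi> x\<bar>\<^sup>2 * V2 (u x))"
      unfolding e_def[abs_def] power2_norm_eq_inner power2_abs by (simp add: power2_eq_square ac_simps)
    moreover have "(\<lambda>x. (norm (gradient \<Phi> x))\<^sup>2 * V1 (u x)) \<in> Cinf a b"
      unfolding power2_norm_eq_inner inner_vec_def gradient_def
      by (simp, intro Cinf_mult Cinf_sum Cinf_partial_deriv p \<Phi>)
    moreover have "(\<lambda>x. \<bar>\<Phi> x\<bar>\<^sup>2 * V2 (u x)) \<in> Cinf a b"
      by (simp, intro Cinf_mult Cinf_power2 q \<Phi>)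
    ultimately show ?thesis unfolding E_def by (simp only:) (intro integral_add Cinf_integrable)
  qed
  finally show ?thesis by (simp add: distrib_left)
qed

section \<open>Uniqueness of the first variation and the Hamilton-Jacobi equation\<close>

text \<open>Testing both derivative formulas with the difference of the candidates makes the
  integral of its square vanish; continuity gives 0 on the box and periodicity everywhere.\<close>

lemma is_first_variation_unique:
  fixes a b :: "real ^ 'n"
  assumes box: "\<And>i. a $ i < b $ i"
    and \<Phi>: "is_first_variation a b W u \<Phi>" and \<Psi>: "is_first_variation a b W u \<Psi>"
  shows "\<Phi> = \<Psi>"
proof -
  define \<eta> where "\<eta> x = \<Phi> x - \<Psi> x" for x
  have C: "\<Phi> \<in> Cinf a b" "\<Psi> \<in> Cinf a b" using \<Phi> \<Psi> by (auto simp: is_first_variation_def)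
  have \<eta>: "\<eta> \<in> Cinf a b" unfolding \<eta>_def[abs_def] using C by (rule Cinf_diff)
  have eq: "integral (cbox a b) (\<lambda>x. \<Phi> x * \<eta> x) = integral (cbox a b) (\<lambda>x. \<Psi> x * \<eta> x)"
    using \<Phi> \<Psi> \<eta> DERIV_unique unfolding is_first_variation_def by blast
  have "integral (cbox a b) (\<lambda>x. (\<eta> x)\<^sup>2)
      = integral (cbox a b) (\<lambda>x. \<Phi> x * \<eta> x - \<Psi> x * \<eta> x)"
    by (simp add: \<eta>_def power2_eq_square left_diff_distrib)
  also have "\<dots> = 0"
    using eq by (subst integral_diff) (auto intro!: Cinf_integrable[of _ a b] Cinf_mult C \<eta>)
  finally have "((\<lambda>x. (\<eta> x)\<^sup>2) has_integral 0) (cbox a b)"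
    using integrable_integral[OF Cinf_integrable[OF Cinf_power2[OF \<eta>]]] by metis
  moreover have "box a b \<noteq> {}" using box by (auto simp: interval_ne_empty_cart)
  moreover have "continuous_on (cbox a b) (\<lambda>x. (\<eta> x)\<^sup>2)"
    using smooth_continuous[OF Cinf_smooth[OF Cinf_power2[OF \<eta>]]] .
  ultimately have zero: "\<eta> x = 0" if "x \<in> cbox a b" for x
    using has_integral_0_cbox_imp_0[of a b "\<lambda>x. (\<eta> x)\<^sup>2" x] that by simp
  have "\<eta> x = 0" for x
    using box_periodic_reduce[OF box, of x] zero \<eta> by (metis (no_types, lifting) Cinf_def mem_Collect_eq)
  then show ?thesis by (auto simp: \<eta>_def)
qed

theorem proposition7:
  fixes a b :: "real ^ 'n"
    and F G R V1 V2 :: "real \<Rightarrow> real"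
    and \<F> :: "(real ^ 'n \<Rightarrow> real) \<Rightarrow> real"
    and U :: "real \<Rightarrow> (real ^ 'n \<Rightarrow> real) \<Rightarrow> real"
  assumes box: "\<And>i. a $ i < b $ i"
    and smooth: "smooth_on_pos F" "smooth_on_pos G" "smooth_on_pos R"
    and F_deriv: "\<And>r. r > 0 \<Longrightarrow> deriv F r > 0"
    and G_deriv: "\<And>r. r > 0 \<Longrightarrow> deriv (deriv G) r > 0"
    and V1: "\<And>r. r > 0 \<Longrightarrow> V1 r = deriv F r / deriv (deriv G) r"
    and V2: "smooth_on_pos V2" "\<And>r. r > 0 \<Longrightarrow> V2 r > 0"
      "\<And>r. r > 0 \<Longrightarrow> V2 r * deriv G r = - R r"
    and U: "value_functional a b U"
  shows "\<forall>t\<in>{0..1}. \<forall>u\<in>pos_densities a b.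
    hamilton_jacobi a b (\<lambda>u \<sigma>. 1/2 * mf_metric a b V1 V2 u \<sigma> \<sigma> - \<F> u) U t u \<longleftrightarrow>
    time_deriv U t u
      + 1/2 * integral (cbox a b)
          (\<lambda>x. (norm (gradient (first_variation a b (U t) u) x))\<^sup>2 * V1 (u x))
      + 1/2 * integral (cbox a b)
          (\<lambda>x. \<bar>first_variation a b (U t) u x\<bar>\<^sup>2 * V2 (u x))
      + \<F> u = 0"
proof (intro ballI)
  fix t :: real and u :: "real ^ 'n \<Rightarrow> real"
  assume t: "t \<in> {0..1}" and u: "u \<in> pos_densities a b"
  let ?\<Phi> = "first_variation a b (U t) u"
  have pos: "u x > 0" for x using u by (simp add: pos_densities_def)
  have p: "(\<lambda>x. V1 (u x)) \<in> Cinf a b"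
  proof -
    \<comment> \<open>\<open>V1\<close> is prescribed on positive arguments only, so smoothness is
      derived after composing with the positive \<open>u\<close>.\<close>
    have "(\<lambda>x. V1 (u x)) = (\<lambda>x. deriv F (u x) * inverse (deriv (deriv G) (u x)))"
      using V1[OF pos] by (simp add: divide_inverse)
    moreover have "(\<lambda>x. deriv F (u x)) \<in> Cinf a b"
      using smooth u by (intro Cinf_compose smooth_on_pos_deriv)
    moreover have "(\<lambda>x. deriv (deriv G) (u x)) \<in> Cinf a b"
      using smooth u by (intro Cinf_compose[of "deriv (deriv G)"] smooth_on_pos_deriv)
    ultimately show ?thesis using G_deriv[OF pos] Cinf_mult Cinf_inverse by metis
  qed
  have p0: "V1 (u x) > 0" for x using V1[OF pos] F_deriv[OF pos] G_deriv[OF pos] by simp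
  have q: "(\<lambda>x. V2 (u x)) \<in> Cinf a b" using Cinf_compose[OF V2(1) u] .
  have q0: "V2 (u x) > 0" for x using V2(2)[OF pos] .
  \<comment> \<open>Existence comes from \<open>value_functional\<close>; with uniqueness the
    definite description in \<open>first_variation\<close> denotes that function.\<close>
  have "\<exists>!\<Phi>. is_first_variation a b (U t) u \<Phi>"
    using U t u is_first_variation_unique[OF box] unfolding value_functional_def by metis
  then have "is_first_variation a b (U t) u ?\<Phi>" unfolding first_variation_def by (rule theI')
  then have \<Phi>: "?\<Phi> \<in> Cinf a b" by (simp add: is_first_variation_def)
  show "hamilton_jacobi a b (\<lambda>u \<sigma>. 1/2 * mf_metric a b V1 V2 u \<sigma> \<sigma> - \<F> u) U t u \<longleftrightarrow>
    time_deriv U t u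
      + 1/2 * integral (cbox a b) (\<lambda>x. (norm (gradient ?\<Phi> x))\<^sup>2 * V1 (u x))
      + 1/2 * integral (cbox a b) (\<lambda>x. \<bar>?\<Phi> x\<bar>\<^sup>2 * V2 (u x)) + \<F> u = 0"
    \<comment> \<open>The Hamiltonian is a finite extended real, so the equation in
      \<open>ereal\<close> becomes one between real numbers.\<close>
    unfolding hamilton_jacobi_def hamiltonian_eq[OF box p p0 q q0 \<Phi>]
    by (simp add: add.assoc zero_ereal_def)
qed

end
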